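(* Let $(F,\Phi)$ be an $A$-module structure on a $q$-variety $F$. Then the $K(T)$-vector space $K(F):=K(T)\otimes_{K[T]}K\{F\}$ has finite dimension. (This dimension is called the rank $r(F)$ of $(F,\Phi)$.)
   Context: $p$ prime, $K$ algebraically closed of characteristic $p$, $q$ a power of $p$, $\mathbb{F}_q\subset K$. $K\{\tau\}$ is the ring (under composition) of $\mathbb{F}_q$-linear polynomials $\sum a_iX^{q^i}$, $\tau=X^q$. $\Lambda_n$ is the left $K\{\tau\}$-module of polynomials $\sum_{i=1}^nP_i(X_i)$, $P_i\in K\{\tau\}$. A $q$-variety is a set $Z(S)=\{x\in K^n: f(x)=0\ \forall f\in S\}$ for some $S\subset\Lambda_n$. For $F\subset K^n$, $M(F)=\{f\in\Lambda_n: f|_F=0\}$ and $K\{F\}:=\Lambda_n/M(F)$, the $\mathbb{F}_q$-linear polynomial functions on $F$. A morphism $F\to H$ of $q$-varieties ($F\subset K^n$, $H\subset K^m$) is a map $x\mapsto(f_1(x),\dots,f_m(x))$ with $f_j\in\Lambda_n$, landing in $H$; $\mathrm{End}(F)$ is the ring of morphisms $F\to F$. For $f=\sum_iP_i(X_i)$ with $P_i=\sum_j a_{j,i}X_i^{q^j}$, set $d(f)=\sum_i a_{0,i}X_i$ (linear part). The tangent space is $T(F)=\{x\in K^n: d(f)(x)=0\ \forall f\in M(F)\}$, and for a morphism $\psi=(f_1,\dots,f_m)$, $d(\psi):T(F)\to T(H)$, $x\mapsto(d(f_1)(x),\dots,d(f_m)(x))$. Let $A=\mathbb{F}_q[T]$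 and $\delta:A\to K$ a fixed $\mathbb{F}_q$-algebra morphism. An $A$-module structure $(F,\Phi)$ is an $\mathbb{F}_q$-algebra morphism $\Phi:A\to\mathrm{End}(F)$, $a\mapsto\Phi_a$, with $d(\Phi_a)=\delta(a)\mathrm{Id}_{T(F)}$ for all $a\in A$. Then $K\{F\}$ is an $A$-module via $a\cdot f=f\circ\Phi_a$, commuting with the $K$-action, hence a $K\otimes_{\mathbb{F}_q}A=K[T]$-module. *)

theory Defs
  imports
    "HOL-Computational_Algebra.Polynomial_Factorial"
    "HOL-Algebra.AbelCoset"
    "HOL-Algebra.Free_Abelian_Groups"
    "Jordan_Normal_Form.VS_Connect"
begin

text \<open>The field \<open>K\<close> is a type \<open>'k\<close> and \<open>K\<^sup>n\<close> is \<open>carrier_vec n\<close>.  The subfield with \<open>q\<close> elements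
  consists of the roots of \<open>X^q - X\<close>, and \<open>A\<close> is a subring of \<open>K[T]\<close> (type \<open>'k poly\<close>).\<close>

definition Fq :: "nat \<Rightarrow> 'k::field set" where
  "Fq q = {c. c ^ q = c}"

definition A_ring :: "nat \<Rightarrow> 'k::field poly ring" where
  "A_ring q = class_ring\<lparr>carrier := {a. \<forall>i. coeff a i \<in> Fq q}\<rparr>"


section \<open>Additive polynomials and \<open>q\<close>-varieties\<close>

definition Ktau :: "nat \<Rightarrow> 'k::field poly set" where
  "Ktau q = {P. \<forall>k. coeff P k \<noteq> 0 \<longrightarrow> (\<exists>i. k = q ^ i)}"

text \<open>The polynomial \<open>P\<^sub>1(X\<^sub>1) + \<dots> + P\<^sub>n(X\<^sub>n)\<close> determines the \<open>P\<^sub>i\<close>, since these have no constant term;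
  it is represented by the vector of the \<open>P\<^sub>i\<close> (indexed from \<open>0\<close>).\<close>

definition Lam :: "nat \<Rightarrow> nat \<Rightarrow> 'k::field poly vec set" where
  "Lam q n = {f \<in> carrier_vec n. \<forall>i<n. f $ i \<in> Ktau q}"

definition ev :: "'k::field poly vec \<Rightarrow> 'k vec \<Rightarrow> 'k" where
  "ev f x = (\<Sum>i<dim_vec f. poly (f $ i) (x $ i))"

definition zero_locus :: "nat \<Rightarrow> 'k::field poly vec set \<Rightarrow> 'k vec set" where
  "zero_locus n S = {x \<in> carrier_vec n. \<forall>f\<in>S. ev f x = 0}"

definition q_variety :: "nat \<Rightarrow> nat \<Rightarrow> 'k::field vec set \<Rightarrow> bool" where
  "q_variety q n F \<longleftrightarrow> (\<exists>S\<subseteq>Lam q n. F = zero_locus n S)"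

definition vanishing :: "nat \<Rightarrow> nat \<Rightarrow> 'k::field vec set \<Rightarrow> 'k poly vec set" where
  "vanishing q n F = {f \<in> Lam q n. \<forall>x\<in>F. ev f x = 0}"


section \<open>Morphisms and tangent spaces\<close>

definition represents ::
    "nat \<Rightarrow> nat \<Rightarrow> nat \<Rightarrow> 'k::field vec set \<Rightarrow> (nat \<Rightarrow> 'k poly vec) \<Rightarrow> ('k vec \<Rightarrow> 'k vec) \<Rightarrow> bool" where
  "represents q n m F g \<phi> \<longleftrightarrow>
     (\<forall>j<m. g j \<in> Lam q n) \<and> (\<forall>x\<in>F. \<phi> x = vec m (\<lambda>j. ev (g j) x))"

definition q_morphisms ::
    "nat \<Rightarrow> nat \<Rightarrow> nat \<Rightarrow> 'k::field vec set \<Rightarrow> 'k vec set \<Rightarrow> ('k vec \<Rightarrow> 'k vec) set" where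
  "q_morphisms q n m F H = {\<phi> \<in> F \<rightarrow>\<^sub>E H. \<exists>g. represents q n m F g \<phi>}"

definition End_ring :: "nat \<Rightarrow> nat \<Rightarrow> 'k::field vec set \<Rightarrow> ('k vec \<Rightarrow> 'k vec) ring" where
  "End_ring q n F =
    \<lparr>carrier = q_morphisms q n n F F,
     monoid.mult = (\<lambda>\<phi> \<psi>. compose F \<phi> \<psi>),
     one = (\<lambda>x\<in>F. x),
     ring.zero = (\<lambda>x\<in>F. 0\<^sub>v n),
     add = (\<lambda>\<phi> \<psi>. \<lambda>x\<in>F. \<phi> x + \<psi> x)\<rparr>"

text \<open>The linear part \<open>d(f)\<close>, as a function: the coefficient \<open>a\<^bsub>0,i\<^esub>\<close> belongs to \<open>X\<^sub>i ^ (q ^ 0)\<close>.\<close>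

definition linpart :: "'k::field poly vec \<Rightarrow> 'k vec \<Rightarrow> 'k" where
  "linpart f x = (\<Sum>i<dim_vec f. coeff (f $ i) 1 * x $ i)"

definition tangent :: "nat \<Rightarrow> nat \<Rightarrow> 'k::field vec set \<Rightarrow> 'k vec set" where
  "tangent q n F = {x \<in> carrier_vec n. \<forall>f\<in>vanishing q n F. linpart f x = 0}"

text \<open>The value does not depend on the chosen polynomials: see \<open>differential_eq\<close> below.\<close>

definition differential ::
    "nat \<Rightarrow> nat \<Rightarrow> nat \<Rightarrow> 'k::field vec set \<Rightarrow> ('k vec \<Rightarrow> 'k vec) \<Rightarrow> ('k vec \<Rightarrow> 'k vec)" where
  "differential q n m F \<phi> =
    (\<lambda>x\<in>tangent q n F. vec m (\<lambda>j. linpart ((SOME g. represents q n m F g \<phi>) j) x))"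

lemma Lam_diff: "f \<in> Lam q n \<Longrightarrow> g \<in> Lam q n \<Longrightarrow> f - g \<in> Lam q n"
proof -
  have "P - Q \<in> Ktau q" if "P \<in> Ktau q" "Q \<in> Ktau q" for P Q :: "'a poly"
    using that unfolding Ktau_def by force
  then show "f \<in> Lam q n \<Longrightarrow> g \<in> Lam q n \<Longrightarrow> f - g \<in> Lam q n"
    by (auto simp: Lam_def)
qed

lemma ev_diff: "f \<in> carrier_vec n \<Longrightarrow> g \<in> carrier_vec n \<Longrightarrow> ev (f - g) x = ev f x - ev g x"
  unfolding ev_def by (simp add: sum_subtractf)

lemma linpart_diff:
  "f \<in> carrier_vec n \<Longrightarrow> g \<in> carrier_vec n \<Longrightarrow> linpart (f - g) x = linpart f x - linpart g x"
  unfolding linpart_def by (simp add: sum_subtractf algebra_simps)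

lemma differential_eq:
  assumes g: "represents q n m F g \<phi>" and x: "x \<in> tangent q n F"
  shows "differential q n m F \<phi> x = vec m (\<lambda>j. linpart (g j) x)"
proof -
  define h where "h = (SOME g. represents q n m F g \<phi>)"
  have h: "represents q n m F h \<phi>"
    unfolding h_def using g by (rule someI[where P = "\<lambda>g. represents q n m F g \<phi>"])
  have "linpart (h j) x = linpart (g j) x" if j: "j < m" for j
  proof -
    have L: "h j \<in> Lam q n" "g j \<in> Lam q n"
      using g h j by (auto simp: represents_def)
    then have c: "h j \<in> carrier_vec n" "g j \<in> carrier_vec n"
      by (auto simp: Lam_def)
    have "ev (h j - g j) y = 0" if "y \<in> F" for y
    proof -
      have "vec m (\<lambda>j. ev (h j) y) $ j = vec m (\<lambda>j. ev (g j) y) $ j"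
        using g h that by (simp add: represents_def)
      then show ?thesis using j by (simp add: ev_diff[OF c])
    qed
    then have "h j - g j \<in> vanishing q n F"
      using L by (simp add: vanishing_def Lam_diff)
    then have "linpart (h j - g j) x = 0"
      using x by (simp add: tangent_def)
    then show ?thesis by (simp add: linpart_diff[OF c])
  qed
  then show ?thesis
    unfolding differential_def h_def[symmetric] using x by auto
qed


section \<open>\<open>A\<close>-module structures\<close>

definition structure_morphism :: "nat \<Rightarrow> ('k::field poly \<Rightarrow> 'k) \<Rightarrow> bool" where
  "structure_morphism q \<delta> \<longleftrightarrow>
     \<delta> \<in> Ring.ring_hom (A_ring q) class_ring \<and> (\<forall>c\<in>Fq q. \<delta> [:c:] = c)"

definition A_module_structure ::
    "nat \<Rightarrow> nat \<Rightarrow> ('k::field poly \<Rightarrow> 'k) \<Rightarrow> 'k vec set \<Rightarrow> ('k poly \<Rightarrow> 'k vec \<Rightarrow> 'k vec) \<Rightarrow> bool" where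
  "A_module_structure q n \<delta> F \<Phi> \<longleftrightarrow>
     \<Phi> \<in> Ring.ring_hom (A_ring q) (End_ring q n F) \<and>
     (\<forall>c\<in>Fq q. \<Phi> [:c:] = (\<lambda>x\<in>F. c \<cdot>\<^sub>v x)) \<and>
     (\<forall>a\<in>carrier (A_ring q). differential q n n F (\<Phi> a) = (\<lambda>x\<in>tangent q n F. \<delta> a \<cdot>\<^sub>v x))"


section \<open>The \<open>K[T]\<close>-module \<open>K{F}\<close>\<close>

text \<open>In records for modules the fields \<open>mult\<close> and \<open>one\<close> are irrelevant.\<close>

definition quot_module :: "('r, 'm, 'z) module_scheme \<Rightarrow> 'm set \<Rightarrow> ('r, 'm set) module" where
  "quot_module M N =
    \<lparr>carrier = a_rcosets\<^bsub>M\<^esub> N, monoid.mult = undefined, one = undefined, ring.zero = N,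
     add = set_add M,
     smult = (\<lambda>r C. N <+>\<^bsub>M\<^esub> ((\<lambda>x. r \<odot>\<^bsub>M\<^esub> x) ` C))\<rparr>"

definition Lam_module :: "nat \<Rightarrow> nat \<Rightarrow> ('k::field, 'k poly vec) module" where
  "Lam_module q n =
    \<lparr>carrier = Lam q n, monoid.mult = undefined, one = undefined, ring.zero = 0\<^sub>v n, add = (+),
     smult = (\<lambda>c f. map_vec (Polynomial.smult c) f)\<rparr>"

definition KF_space :: "nat \<Rightarrow> nat \<Rightarrow> 'k::field vec set \<Rightarrow> ('k, 'k poly vec set) module" where
  "KF_space q n F = quot_module (Lam_module q n) (vanishing q n F)"

text \<open>The class \<open>a \<cdot> [f] = [f \<circ> \<Phi>\<^sub>a]\<close> consists of all elements of \<open>\<Lambda>\<^sub>n\<close> that agree with \<open>f \<circ> \<Phi>\<^sub>a\<close> on \<open>F\<close>.\<close>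

definition A_act ::
    "nat \<Rightarrow> nat \<Rightarrow> 'k::field vec set \<Rightarrow> ('k poly \<Rightarrow> 'k vec \<Rightarrow> 'k vec) \<Rightarrow>
     'k poly \<Rightarrow> 'k poly vec set \<Rightarrow> 'k poly vec set" where
  "A_act q n F \<Phi> a C = {h \<in> Lam q n. \<exists>f\<in>C. \<forall>x\<in>F. ev h x = ev f (\<Phi> a x)}"

text \<open>Under \<open>K \<otimes> A = K[T]\<close> the polynomial \<open>\<Sum>i. c\<^sub>i T^i\<close> is \<open>\<Sum>i. c\<^sub>i \<otimes> T^i\<close>.\<close>

definition KF_module ::
    "nat \<Rightarrow> nat \<Rightarrow> 'k::field vec set \<Rightarrow> ('k poly \<Rightarrow> 'k vec \<Rightarrow> 'k vec) \<Rightarrow>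
     ('k poly, 'k poly vec set) module" where
  "KF_module q n F \<Phi> =
    \<lparr>carrier = carrier (KF_space q n F), monoid.mult = undefined, one = undefined,
     ring.zero = ring.zero (KF_space q n F), add = add (KF_space q n F),
     smult = (\<lambda>P C. finsum (KF_space q n F)
       (\<lambda>i. coeff P i \<odot>\<^bsub>KF_space q n F\<^esub> A_act q n F \<Phi> (monom 1 i) C) {..degree P})\<rparr>"


section \<open>Extension of scalars\<close>

text \<open>For a homomorphism \<open>h : R \<rightarrow> S\<close> of commutative rings and an \<open>R\<close>-module \<open>M\<close>, the \<open>S\<close>-module
  \<open>S \<otimes>\<^sub>R M\<close> is the free abelian group on the pairs \<open>(s, m)\<close> modulo the relations of biadditivity
  and \<open>R\<close>-balancedness.\<close>

definition tensor_free ::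
    "('s, 'y) ring_scheme \<Rightarrow> ('r, 'm, 'z) module_scheme \<Rightarrow> (('s \<times> 'm) \<Rightarrow>\<^sub>0 int) monoid" where
  "tensor_free S M = free_Abelian_group (carrier S \<times> carrier M)"

definition tensor_rel ::
    "('r, 'x) ring_scheme \<Rightarrow> ('s, 'y) ring_scheme \<Rightarrow> ('r \<Rightarrow> 's) \<Rightarrow> ('r, 'm, 'z) module_scheme \<Rightarrow>
     (('s \<times> 'm) \<Rightarrow>\<^sub>0 int) set" where
  "tensor_rel R S h M = generate (tensor_free S M)
    ({frag_of (s \<oplus>\<^bsub>S\<^esub> t, m) - frag_of (s, m) - frag_of (t, m) | s t m.
        s \<in> carrier S \<and> t \<in> carrier S \<and> m \<in> carrier M} \<union>
     {frag_of (s, m \<oplus>\<^bsub>M\<^esub> m') - frag_of (s, m) - frag_of (s, m') | s m m'.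
        s \<in> carrier S \<and> m \<in> carrier M \<and> m' \<in> carrier M} \<union>
     {frag_of (s \<otimes>\<^bsub>S\<^esub> h r, m) - frag_of (s, r \<odot>\<^bsub>M\<^esub> m) | s r m.
        s \<in> carrier S \<and> r \<in> carrier R \<and> m \<in> carrier M})"

definition base_change ::
    "('r, 'x) ring_scheme \<Rightarrow> ('s, 'y) ring_scheme \<Rightarrow> ('r \<Rightarrow> 's) \<Rightarrow> ('r, 'm, 'z) module_scheme \<Rightarrow>
     ('s, (('s \<times> 'm) \<Rightarrow>\<^sub>0 int) set) module" where
  "base_change R S h M =
    \<lparr>carrier = carrier (tensor_free S M Mod tensor_rel R S h M),
     monoid.mult = undefined, one = undefined,
     ring.zero = one (tensor_free S M Mod tensor_rel R S h M),
     add = monoid.mult (tensor_free S M Mod tensor_rel R S h M),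
     smult = (\<lambda>s C. tensor_rel R S h M <#>\<^bsub>tensor_free S M\<^esub>
       (frag_extend (\<lambda>(t, m). frag_of (s \<otimes>\<^bsub>S\<^esub> t, m)) ` C))\<rparr>"

definition KF_generic ::
    "nat \<Rightarrow> nat \<Rightarrow> 'k::field vec set \<Rightarrow> ('k poly \<Rightarrow> 'k vec \<Rightarrow> 'k vec) \<Rightarrow>
     ('k poly fract, (('k poly fract \<times> 'k poly vec set) \<Rightarrow>\<^sub>0 int) set) module" where
  "KF_generic q n F \<Phi> = base_change class_ring class_ring to_fract (KF_module q n F \<Phi>)"

end

theory Submission
  imports Defs
begin

text \<open>Writing elements of \<open>K{F}\<close> as functions on \<open>F\<close>, the variable \<open>T\<close> acts by composition with
  \<open>\<Phi>\<^sub>T\<close>, which raises the \<open>\<tau>\<close>-degree by at most a constant \<open>d\<close>, while the functions of \<open>\<tau>\<close>-degree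
  at most \<open>s\<close> span a \<open>K\<close>-space of dimension at most \<open>n (s + 1)\<close>.  If \<open>r\<close> elements of \<open>\<tau>\<close>-degree at
  most \<open>s\<close> are linearly independent over \<open>K[T]\<close>, then comparing dimensions gives
  \<open>r (N + 1) \<le> n (s + N d + 1)\<close> for all \<open>N\<close>, hence \<open>r \<le> n d\<close>.  A relation over \<open>K[T]\<close> between elements
  \<open>m\<close> yields one over \<open>K(T)\<close> between the elements \<open>1 \<otimes> m\<close>; as these generate \<open>K(F)\<close>, its dimension is
  at most \<open>n d\<close>.\<close>

section \<open>Extension of scalars\<close>

locale extension_of_scalars =
  M: Module.module R M + S: cring S
  for R :: "('r, 'x) ring_scheme" and M :: "('r, 'm, 'z) module_scheme"
    and S :: "('s, 'y) ring_scheme" +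
  fixes h :: "'r \<Rightarrow> 's"
  assumes h_closed: "r \<in> carrier R \<Longrightarrow> h r \<in> carrier S"
begin

section \<open>The free abelian group on pairs, and multiplication by scalars on it\<close>

abbreviation "G \<equiv> tensor_free S M"
abbreviation "N \<equiv> tensor_rel R S h M"
abbreviation "B \<equiv> base_change R S h M"

text \<open>A name for the lift of the scalar multiplication of \<open>base_change\<close> to the
  free group, so that the module laws can be checked before passing to cosets.\<close>

definition scale :: "'s \<Rightarrow> ('s \<times> 'm \<Rightarrow>\<^sub>0 int) \<Rightarrow> ('s \<times> 'm \<Rightarrow>\<^sub>0 int)" where
  "scale s = frag_extend (\<lambda>(t, m). frag_of (s \<otimes>\<^bsub>S\<^esub> t, m))"

definition tensor :: "'s \<Rightarrow> 'm \<Rightarrow> ('s \<times> 'm \<Rightarrow>\<^sub>0 int) set" where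
  "tensor s m = N #>\<^bsub>G\<^esub> frag_of (s, m)"

sublocale G: comm_group G
  unfolding tensor_free_def by (rule abelian_free_Abelian_group)

lemma carrier_G [simp]: "x \<in> carrier G \<longleftrightarrow> Poly_Mapping.keys x \<subseteq> carrier S \<times> carrier M"
  by (simp add: tensor_free_def)

lemma mult_G [simp]: "x \<otimes>\<^bsub>G\<^esub> y = x + y" and one_G [simp]: "\<one>\<^bsub>G\<^esub> = 0"
  by (simp_all add: tensor_free_def)

lemma inv_G [simp]: "x \<in> carrier G \<Longrightarrow> inv\<^bsub>G\<^esub> x = - x"
  by (simp add: tensor_free_def)

lemma G_add: "x \<in> carrier G \<Longrightarrow> y \<in> carrier G \<Longrightarrow> x + y \<in> carrier G"
  using G.m_closed by simp

lemma G_uminus: "x \<in> carrier G \<Longrightarrow> - x \<in> carrier G"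
  using G.inv_closed by simp

lemma G_diff: "x \<in> carrier G \<Longrightarrow> y \<in> carrier G \<Longrightarrow> x - y \<in> carrier G"
  using G_add[OF _ G_uminus] by simp

lemma G_frag_of: "s \<in> carrier S \<Longrightarrow> m \<in> carrier M \<Longrightarrow> frag_of (s, m) \<in> carrier G"
  by simp

text \<open>The elements of a free abelian group are the integer combinations of its generators. The
  single case of differences covers both sums and negatives, and additive maps respect it
  directly.\<close>

lemma G_induct [consumes 1, case_names zero diff frag_of]:
  assumes "x \<in> carrier G" and "P 0"
    and "\<And>x y. x \<in> carrier G \<Longrightarrow> y \<in> carrier G \<Longrightarrow> P x \<Longrightarrow> P y \<Longrightarrow> P (x - y)"
    and "\<And>s m. s \<in> carrier S \<Longrightarrow> m \<in> carrier M \<Longrightarrow> P (frag_of (s, m))"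
  shows "P x"
  using assms by (intro free_Abelian_group_induct[of x "carrier S \<times> carrier M" P]) auto

lemma scale_0 [simp]: "scale s 0 = 0"
  by (simp add: scale_def)

lemma scale_frag_of [simp]: "scale s (frag_of (t, m)) = frag_of (s \<otimes>\<^bsub>S\<^esub> t, m)"
  by (simp add: scale_def)

lemma scale_diff: "scale s (x - y) = scale s x - scale s y"
  and scale_add: "scale s (x + y) = scale s x + scale s y"
  and scale_uminus: "scale s (- x) = - scale s x"
  by (simp_all add: scale_def frag_extend_diff frag_extend_add frag_extend_minus)

lemma scale_closed:
  assumes s: "s \<in> carrier S"
  shows "x \<in> carrier G \<Longrightarrow> scale s x \<in> carrier G"
proof (induction x rule: G_induct)
  case (diff x y)
  then show ?case using G_diff[of "scale s x" "scale s y"] by (simp add: scale_diff)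
qed (auto simp: s)

section \<open>The subgroup of relations and its stability under scaling\<close>

definition relations :: "('s \<times> 'm \<Rightarrow>\<^sub>0 int) set" where
  "relations = {frag_of (s \<oplus>\<^bsub>S\<^esub> t, m) - frag_of (s, m) - frag_of (t, m) | s t m.
        s \<in> carrier S \<and> t \<in> carrier S \<and> m \<in> carrier M} \<union>
     {frag_of (s, m \<oplus>\<^bsub>M\<^esub> m') - frag_of (s, m) - frag_of (s, m') | s m m'.
        s \<in> carrier S \<and> m \<in> carrier M \<and> m' \<in> carrier M} \<union>
     {frag_of (s \<otimes>\<^bsub>S\<^esub> h r, m) - frag_of (s, r \<odot>\<^bsub>M\<^esub> m) | s r m.
        s \<in> carrier S \<and> r \<in> carrier R \<and> m \<in> carrier M}"

lemma N_eq: "N = generate G relations"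
  by (simp add: tensor_rel_def relations_def)

lemma relations_closed: "relations \<subseteq> carrier G"
  unfolding relations_def
  by (auto simp del: carrier_G intro!: G_diff G_frag_of h_closed)

lemma N_subgroup: "subgroup N G"
  unfolding N_eq using relations_closed by (rule G.generate_is_subgroup)

sublocale N: normal N G
  using N_subgroup by (simp add: G.normal_iff_subgroup)

lemma N_add: "x \<in> N \<Longrightarrow> y \<in> N \<Longrightarrow> x + y \<in> N"
  using N.m_closed by simp

lemma N_uminus:
  assumes "x \<in> N"
  shows "- x \<in> N"
  using N.m_inv_closed[OF assms] inv_G[OF N.mem_carrier[OF assms]] by metis

lemma N_diff: "x \<in> N \<Longrightarrow> y \<in> N \<Longrightarrow> x - y \<in> N"
  using N_add[OF _ N_uminus] by simp

text \<open>Multiplying the first entry by \<open>s\<close> turns a relation into one of the same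
  family: by distributivity in the first family, directly in the second, and by associativity in the
  third.\<close>

lemma scale_relations: "s \<in> carrier S \<Longrightarrow> x \<in> relations \<Longrightarrow> scale s x \<in> relations"
proof -
  assume s: "s \<in> carrier S" and "x \<in> relations"
  then consider
    (a) u t m where "x = frag_of (u \<oplus>\<^bsub>S\<^esub> t, m) - frag_of (u, m) - frag_of (t, m)"
        "u \<in> carrier S" "t \<in> carrier S" "m \<in> carrier M"
  | (b) u m m' where "x = frag_of (u, m \<oplus>\<^bsub>M\<^esub> m') - frag_of (u, m) - frag_of (u, m')"
        "u \<in> carrier S" "m \<in> carrier M" "m' \<in> carrier M"
  | (c) u r m where "x = frag_of (u \<otimes>\<^bsub>S\<^esub> h r, m) - frag_of (u, r \<odot>\<^bsub>M\<^esub> m)"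
        "u \<in> carrier S" "r \<in> carrier R" "m \<in> carrier M"
    unfolding relations_def by blast
  then show ?thesis
  proof cases
    case a
    with s show ?thesis unfolding relations_def
      by (intro UnI1 CollectI exI[of _ "s \<otimes>\<^bsub>S\<^esub> u"] exI[of _ "s \<otimes>\<^bsub>S\<^esub> t"] exI[of _ m])
         (simp add: scale_diff S.r_distr)
  next
    case b
    with s show ?thesis unfolding relations_def
      by (intro UnI1[OF UnI2] CollectI exI[of _ "s \<otimes>\<^bsub>S\<^esub> u"] exI[of _ m] exI[of _ m'])
         (simp add: scale_diff)
  next
    case c
    with s show ?thesis unfolding relations_def
      by (intro UnI2 CollectI exI[of _ "s \<otimes>\<^bsub>S\<^esub> u"] exI[of _ r] exI[of _ m])
         (simp add: scale_diff S.m_assoc h_closed)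
  qed
qed

text \<open>Since \<open>scale\<close> is additive, stability passes from the generators to the
  subgroup. This makes the multiplication of cosets by scalars well defined.\<close>

lemma scale_N:
  assumes s: "s \<in> carrier S" and x: "x \<in> N"
  shows "scale s x \<in> N"
  using x unfolding N_eq
proof (induction rule: generate.induct)
  case one
  then show ?case using generate.one[of G relations] by simp
next
  case (incl x)
  then show ?case using scale_relations[OF s] by (blast intro: generate.incl)
next
  case (inv x)
  then have "inv\<^bsub>G\<^esub> scale s x \<in> generate G relations"
    using scale_relations[OF s] by (blast intro: generate.inv)
  moreover have "x \<in> carrier G" using inv relations_closed by blast
  ultimately show ?case using scale_closed[OF s, of x] by (simp add: scale_uminus)
next
  case (eng x y)
  then show ?case using generate.eng[of "scale s x" G relations] by (simp add: scale_add)
qed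

section \<open>The quotient by the relations as a module over S\<close>

lemma coset_eq_iff:
  assumes "x \<in> carrier G" and "y \<in> carrier G"
  shows "N #>\<^bsub>G\<^esub> x = N #>\<^bsub>G\<^esub> y \<longleftrightarrow> x - y \<in> N"
proof -
  have "x - y \<in> N \<longleftrightarrow> x \<in> N #>\<^bsub>G\<^esub> y"
    using N.rcos_module[OF G.is_group assms(2,1)] assms by simp
  also have "\<dots> \<longleftrightarrow> N #>\<^bsub>G\<^esub> x = N #>\<^bsub>G\<^esub> y"
    using G.repr_independence[OF _ assms(2) N_subgroup] G.rcos_self[OF assms(1) N_subgroup]
    by metis
  finally show ?thesis by simp
qed

lemma carrier_B: "carrier B = {N #>\<^bsub>G\<^esub> x | x. x \<in> carrier G}"
  by (auto simp: base_change_def FactGroup_def RCOSETS_def simp del: carrier_G)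

lemma coset_closed: "x \<in> carrier G \<Longrightarrow> N #>\<^bsub>G\<^esub> x \<in> carrier B"
  unfolding carrier_B by blast

lemma add_B:
  "x \<in> carrier G \<Longrightarrow> y \<in> carrier G \<Longrightarrow> (N #>\<^bsub>G\<^esub> x) \<oplus>\<^bsub>B\<^esub> (N #>\<^bsub>G\<^esub> y) = N #>\<^bsub>G\<^esub> (x + y)"
  using N.rcos_sum[of x y] by (simp add: base_change_def)

lemma zero_B: "\<zero>\<^bsub>B\<^esub> = N #>\<^bsub>G\<^esub> 0"
  using N.rcos_const[OF G.is_group, of 0] N.one_closed by (simp add: base_change_def)

lemma uminus_B: "x \<in> carrier G \<Longrightarrow> (N #>\<^bsub>G\<^esub> - x) \<oplus>\<^bsub>B\<^esub> (N #>\<^bsub>G\<^esub> x) = \<zero>\<^bsub>B\<^esub>"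
  by (simp add: add_B zero_B G_uminus del: carrier_G)

lemma abelian_group_B: "abelian_group B"
proof (rule abelian_groupI)
  show "\<zero>\<^bsub>B\<^esub> \<in> carrier B"
    unfolding zero_B by (rule coset_closed) simp
  fix x assume "x \<in> carrier B"
  then obtain x' where x: "x' \<in> carrier G" "x = N #>\<^bsub>G\<^esub> x'" unfolding carrier_B by blast
  show "\<zero>\<^bsub>B\<^esub> \<oplus>\<^bsub>B\<^esub> x = x"
    using x add_B[of 0 x'] by (simp add: zero_B)
  show "\<exists>y\<in>carrier B. y \<oplus>\<^bsub>B\<^esub> x = \<zero>\<^bsub>B\<^esub>"
    using x uminus_B coset_closed G_uminus by blast
  fix y assume "y \<in> carrier B"
  then obtain y' where y: "y' \<in> carrier G" "y = N #>\<^bsub>G\<^esub> y'" unfolding carrier_B by blast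
  show "x \<oplus>\<^bsub>B\<^esub> y \<in> carrier B"
    using x y by (simp add: add_B coset_closed G_add del: carrier_G)
  show "x \<oplus>\<^bsub>B\<^esub> y = y \<oplus>\<^bsub>B\<^esub> x"
    using x y by (simp add: add_B add.commute del: carrier_G)
  fix z assume "z \<in> carrier B"
  then obtain z' where z: "z' \<in> carrier G" "z = N #>\<^bsub>G\<^esub> z'" unfolding carrier_B by blast
  show "x \<oplus>\<^bsub>B\<^esub> y \<oplus>\<^bsub>B\<^esub> z = x \<oplus>\<^bsub>B\<^esub> (y \<oplus>\<^bsub>B\<^esub> z)"
    using x y z by (simp add: add_B G_add add.assoc del: carrier_G)
qed

text \<open>\<open>base_change\<close> adds all of \<open>N\<close> to the image of a coset under
  scaling. The elements of the coset contribute further terms \<open>scale s k\<close> with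
  \<open>k \<in> N\<close>, and \<open>scale_N\<close> absorbs them.\<close>

lemma smult_B:
  assumes s: "s \<in> carrier S" and x: "x \<in> carrier G"
  shows "s \<odot>\<^bsub>B\<^esub> (N #>\<^bsub>G\<^esub> x) = N #>\<^bsub>G\<^esub> scale s x"
proof -
  have "s \<odot>\<^bsub>B\<^esub> (N #>\<^bsub>G\<^esub> x) = {n + scale s (k + x) | n k. n \<in> N \<and> k \<in> N}"
    by (auto simp: base_change_def scale_def set_mult_def r_coset_def)
  also have "\<dots> = {n + scale s x | n. n \<in> N}" (is "?A = ?B")
  proof
    show "?A \<subseteq> ?B"
      using N_add[OF _ scale_N[OF s]] by (auto simp: scale_add add.assoc[symmetric])
    show "?B \<subseteq> ?A"
      using N.one_closed by force
  qed
  also have "\<dots> = N #>\<^bsub>G\<^esub> scale s x"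
    by (auto simp: r_coset_def)
  finally show ?thesis .
qed

lemma module_B: "Module.module S B"
proof (rule moduleI)
  fix x assume "x \<in> carrier B"
  then obtain x' where x': "x' \<in> carrier G" "x = N #>\<^bsub>G\<^esub> x'" unfolding carrier_B by blast
  have "scale \<one>\<^bsub>S\<^esub> x' = x'"
    using x'(1) by (induction rule: G_induct) (simp_all add: scale_diff)
  then show "\<one>\<^bsub>S\<^esub> \<odot>\<^bsub>B\<^esub> x = x"
    using x' by (simp only: smult_B S.one_closed)
  fix s assume s: "s \<in> carrier S"
  show "s \<odot>\<^bsub>B\<^esub> x \<in> carrier B"
    using s x' by (simp add: smult_B coset_closed scale_closed del: carrier_G)
  {
    fix y assume "y \<in> carrier B"
    then obtain y' where y': "y' \<in> carrier G" "y = N #>\<^bsub>G\<^esub> y'" unfolding carrier_B by blast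
    show "s \<odot>\<^bsub>B\<^esub> (x \<oplus>\<^bsub>B\<^esub> y) = s \<odot>\<^bsub>B\<^esub> x \<oplus>\<^bsub>B\<^esub> s \<odot>\<^bsub>B\<^esub> y"
      using s x' y' by (simp add: smult_B add_B G_add scale_closed scale_add del: carrier_G)
  }
  fix t assume t: "t \<in> carrier S"
  have "scale (s \<otimes>\<^bsub>S\<^esub> t) x' = scale s (scale t x')"
    using x'(1) by (induction rule: G_induct) (simp_all add: scale_diff S.m_assoc s t)
  then show "(s \<otimes>\<^bsub>S\<^esub> t) \<odot>\<^bsub>B\<^esub> x = s \<odot>\<^bsub>B\<^esub> (t \<odot>\<^bsub>B\<^esub> x)"
    using s t x' by (simp add: smult_B scale_closed del: carrier_G)
  \<comment> \<open>Scaling is additive in the scalar only modulo \<open>N\<close>, whereas the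
    other laws hold in the free group already. Both sides are additive in \<open>x'\<close>, so
    generators suffice, and there the difference belongs to the first family of relations.\<close>
  have "scale (s \<oplus>\<^bsub>S\<^esub> t) x' - (scale s x' + scale t x') \<in> N"
    using x'(1)
  proof (induction rule: G_induct)
    case zero
    then show ?case using N.one_closed by simp
  next
    case (diff x y)
    from N_diff[OF diff(3,4)] show ?case by (simp add: scale_diff algebra_simps)
  next
    case (frag_of u m)
    have "frag_of (s \<otimes>\<^bsub>S\<^esub> u \<oplus>\<^bsub>S\<^esub> t \<otimes>\<^bsub>S\<^esub> u, m) - frag_of (s \<otimes>\<^bsub>S\<^esub> u, m) - frag_of (t \<otimes>\<^bsub>S\<^esub> u, m) \<in> relations"
      unfolding relations_def using s t frag_of by blast
    then show ?case
      unfolding N_eq using s t frag_of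
      by (auto simp: S.l_distr algebra_simps intro: generate.incl)
  qed
  then show "(s \<oplus>\<^bsub>S\<^esub> t) \<odot>\<^bsub>B\<^esub> x = s \<odot>\<^bsub>B\<^esub> x \<oplus>\<^bsub>B\<^esub> t \<odot>\<^bsub>B\<^esub> x"
    using s t x' by (simp add: smult_B add_B G_add scale_closed coset_eq_iff del: carrier_G)
qed (fact S.is_cring abelian_group_B)+

sublocale B: Module.module S B by (rule module_B)

section \<open>Pure tensors\<close>

lemma tensor_closed: "s \<in> carrier S \<Longrightarrow> m \<in> carrier M \<Longrightarrow> tensor s m \<in> carrier B"
  unfolding tensor_def by (rule coset_closed) simp

lemma smult_tensor:
  "s \<in> carrier S \<Longrightarrow> t \<in> carrier S \<Longrightarrow> m \<in> carrier M \<Longrightarrow> s \<odot>\<^bsub>B\<^esub> tensor t m = tensor (s \<otimes>\<^bsub>S\<^esub> t) m"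
  unfolding tensor_def by (simp add: smult_B)

lemma tensor_add:
  assumes "s \<in> carrier S" "m \<in> carrier M" "m' \<in> carrier M"
  shows "tensor s (m \<oplus>\<^bsub>M\<^esub> m') = tensor s m \<oplus>\<^bsub>B\<^esub> tensor s m'"
proof -
  have "frag_of (s, m \<oplus>\<^bsub>M\<^esub> m') - frag_of (s, m) - frag_of (s, m') \<in> N"
    unfolding N_eq relations_def using assms by (intro generate.incl) blast
  then show ?thesis
    using assms unfolding tensor_def
    by (simp add: add_B coset_eq_iff G_add G_frag_of diff_diff_eq del: carrier_G)
qed

lemma tensor_zero: "s \<in> carrier S \<Longrightarrow> tensor s \<zero>\<^bsub>M\<^esub> = \<zero>\<^bsub>B\<^esub>"
  using tensor_add[of s "\<zero>\<^bsub>M\<^esub>" "\<zero>\<^bsub>M\<^esub>"] tensor_closed[of s "\<zero>\<^bsub>M\<^esub>"]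
  by (simp add: B.add.r_cancel_one')

lemma tensor_sum:
  assumes s: "s \<in> carrier S" and "finite I" and "\<And>i. i \<in> I \<Longrightarrow> f i \<in> carrier M"
  shows "tensor s (finsum M f I) = finsum B (\<lambda>i. tensor s (f i)) I"
  using assms(2,3)
proof (induction I rule: finite_induct)
  case empty
  then show ?case using s by (simp add: tensor_zero)
next
  case (insert i I)
  then have "finsum M f (insert i I) = f i \<oplus>\<^bsub>M\<^esub> finsum M f I"
    by (intro M.finsum_insert) auto
  moreover have "finsum B (\<lambda>i. tensor s (f i)) (insert i I) =
      tensor s (f i) \<oplus>\<^bsub>B\<^esub> finsum B (\<lambda>i. tensor s (f i)) I"
    using insert s by (intro B.finsum_insert) (auto intro: tensor_closed)
  ultimately show ?case
    using insert s by (simp add: tensor_add M.finsum_closed Pi_def)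
qed

lemma tensor_balanced:
  assumes "s \<in> carrier S" "r \<in> carrier R" "m \<in> carrier M"
  shows "tensor s (r \<odot>\<^bsub>M\<^esub> m) = tensor (s \<otimes>\<^bsub>S\<^esub> h r) m"
proof -
  have "frag_of (s \<otimes>\<^bsub>S\<^esub> h r, m) - frag_of (s, r \<odot>\<^bsub>M\<^esub> m) \<in> N"
    unfolding N_eq relations_def using assms by (intro generate.incl) blast
  then have "tensor (s \<otimes>\<^bsub>S\<^esub> h r) m = tensor s (r \<odot>\<^bsub>M\<^esub> m)"
    unfolding tensor_def using assms
    by (subst coset_eq_iff) (simp_all add: G_frag_of h_closed)
  then show ?thesis ..
qed

text \<open>Every element is an integer combination of pure tensors, and the tensor of
  \<open>s\<close> and \<open>m\<close> is \<open>s\<close> times the tensor of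
  \<open>\<one>\<close> and \<open>m\<close>.\<close>

lemma span_tensor: "B.span (tensor \<one>\<^bsub>S\<^esub> ` carrier M) = carrier B"
proof
  have sub: "tensor \<one>\<^bsub>S\<^esub> ` carrier M \<subseteq> carrier B" by (auto intro: tensor_closed)
  then show "B.span (tensor \<one>\<^bsub>S\<^esub> ` carrier M) \<subseteq> carrier B" by (rule B.span_is_subset2)
  note W = B.span_is_submodule[OF sub]
  show "carrier B \<subseteq> B.span (tensor \<one>\<^bsub>S\<^esub> ` carrier M)" (is "_ \<subseteq> ?W")
  proof
    fix v assume "v \<in> carrier B"
    then obtain x where x: "x \<in> carrier G" "v = N #>\<^bsub>G\<^esub> x" unfolding carrier_B by blast
    from x(1) have "N #>\<^bsub>G\<^esub> x \<in> ?W"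
    proof (induction rule: G_induct)
      case zero
      then show ?case using submodule.zero_closed[OF W] by (simp add: zero_B)
    next
      case (diff x y)
      \<comment> \<open>The span is closed under negation because negation is multiplication by the
        scalar -1.\<close>
      have "N #>\<^bsub>G\<^esub> - y = \<ominus>\<^bsub>B\<^esub> (N #>\<^bsub>G\<^esub> y)"
        using uminus_B[of y] diff
        by (intro B.minus_equality[symmetric]) (auto intro!: coset_closed G_uminus simp del: carrier_G)
      also have "\<dots> = (\<ominus>\<^bsub>S\<^esub> \<one>\<^bsub>S\<^esub>) \<odot>\<^bsub>B\<^esub> (N #>\<^bsub>G\<^esub> y)"
        using diff coset_closed by (simp add: B.smult_l_minus del: carrier_G)
      also have "\<dots> \<in> ?W"
        using diff by (intro submodule.smult_closed[OF W]) auto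
      finally have "(N #>\<^bsub>G\<^esub> x) \<oplus>\<^bsub>B\<^esub> (N #>\<^bsub>G\<^esub> - y) \<in> ?W"
        using submodule.m_closed[OF W] diff by blast
      then show ?case using diff by (simp add: add_B G_uminus del: carrier_G)
    next
      case (frag_of s m)
      have "s \<odot>\<^bsub>B\<^esub> tensor \<one>\<^bsub>S\<^esub> m \<in> ?W"
        using frag_of B.in_own_span[OF sub] by (intro submodule.smult_closed[OF W]) auto
      then show ?case using frag_of by (simp add: smult_tensor) (simp add: tensor_def)
    qed
    then show "v \<in> ?W" by (simp add: x)
  qed
qed

text \<open>Balancing carries a relation with coefficients \<open>a x\<close> to one with
  coefficients \<open>h (a x)\<close>, and the trivial kernel of \<open>h\<close> keeps a nonzero
  coefficient nonzero.\<close>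

lemma lin_dep_tensor:
  assumes h_inj: "\<And>r. r \<in> carrier R \<Longrightarrow> h r = \<zero>\<^bsub>S\<^esub> \<Longrightarrow> r = \<zero>\<^bsub>R\<^esub>"
    and X: "finite X" "X \<subseteq> carrier M" "M.lin_dep X" and inj: "inj_on (tensor \<one>\<^bsub>S\<^esub>) X"
  shows "B.lin_dep (tensor \<one>\<^bsub>S\<^esub> ` X)"
proof -
  obtain a v where a: "a \<in> X \<rightarrow> carrier R" "M.lincomb a X = \<zero>\<^bsub>M\<^esub>" and v: "v \<in> X" "a v \<noteq> \<zero>\<^bsub>R\<^esub>"
    using M.finite_lin_dep[OF X(1,3,2)] by blast
  \<comment> \<open>Coefficients of a linear combination are indexed by vectors, so the coefficient
    of \<open>x\<close> is moved to its tensor through the inverse of the injection.\<close>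
  define b where "b y = h (a (the_inv_into X (tensor \<one>\<^bsub>S\<^esub>) y))" for y
  have b: "b (tensor \<one>\<^bsub>S\<^esub> x) = h (a x)" if "x \<in> X" for x
    using that inj by (simp add: b_def the_inv_into_f_f)
  have ha: "h (a x) \<in> carrier S" if "x \<in> X" for x
    using that a by (auto intro: h_closed)
  have "B.lincomb b (tensor \<one>\<^bsub>S\<^esub> ` X) = (\<Oplus>\<^bsub>B\<^esub>x\<in>X. b (tensor \<one>\<^bsub>S\<^esub> x) \<odot>\<^bsub>B\<^esub> tensor \<one>\<^bsub>S\<^esub> x)"
    unfolding B.lincomb_def using inj X ha b
    by (intro B.finsum_reindex) (auto intro!: B.smult_closed tensor_closed)
  also have "\<dots> = (\<Oplus>\<^bsub>B\<^esub>x\<in>X. tensor \<one>\<^bsub>S\<^esub> (a x \<odot>\<^bsub>M\<^esub> x))"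
  proof (rule B.finsum_cong')
    show "b (tensor \<one>\<^bsub>S\<^esub> x) \<odot>\<^bsub>B\<^esub> tensor \<one>\<^bsub>S\<^esub> x = tensor \<one>\<^bsub>S\<^esub> (a x \<odot>\<^bsub>M\<^esub> x)" if "x \<in> X" for x
    proof -
      have "x \<in> carrier M" "a x \<in> carrier R" using that X a by auto
      then show ?thesis
        using that ha by (simp add: b smult_tensor tensor_balanced)
    qed
    show "(\<lambda>x. tensor \<one>\<^bsub>S\<^esub> (a x \<odot>\<^bsub>M\<^esub> x)) \<in> X \<rightarrow> carrier B"
      using X a by (intro Pi_I tensor_closed M.smult_closed) auto
  qed simp
  also have "\<dots> = tensor \<one>\<^bsub>S\<^esub> (M.lincomb a X)"
    unfolding M.lincomb_def using X a by (intro tensor_sum[symmetric]) auto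
  finally have "B.lincomb b (tensor \<one>\<^bsub>S\<^esub> ` X) = \<zero>\<^bsub>B\<^esub>"
    using a by (simp add: tensor_zero)
  moreover have "b (tensor \<one>\<^bsub>S\<^esub> v) \<noteq> \<zero>\<^bsub>S\<^esub>"
    using h_inj[of "a v"] v a b by auto
  ultimately show ?thesis
    using X v b ha
    by (intro B.lin_dep_crit[of "tensor \<one>\<^bsub>S\<^esub> ` X" _ b "tensor \<one>\<^bsub>S\<^esub> v"]) auto
qed

text \<open>An independent set of generators, that is of tensors with first entry
  \<open>\<one>\<close>, is the injective image of a subset of \<open>M\<close>, so by
  \<open>lin_dep_tensor\<close> it has at most \<open>D\<close> elements. Hence there is a maximal
  one, and it spans.\<close>

lemma fin_dim_base_change:
  assumes field: "field S"
    and h_inj: "\<And>r. r \<in> carrier R \<Longrightarrow> h r = \<zero>\<^bsub>S\<^esub> \<Longrightarrow> r = \<zero>\<^bsub>R\<^esub>"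
    and bound: "\<And>X. finite X \<Longrightarrow> X \<subseteq> carrier M \<Longrightarrow> D < card X \<Longrightarrow> M.lin_dep X"
  shows "vectorspace S B \<and> vectorspace.fin_dim S B"
proof
  show "vectorspace S B"
    using module_B field by (simp add: vectorspace_def)
  then interpret V: vectorspace S B .
  let ?E = "tensor \<one>\<^bsub>S\<^esub> ` carrier M"
  have E: "?E \<subseteq> carrier B" by (auto intro: tensor_closed)
  have dep: "B.lin_dep Y" if Y: "finite Y" "Y \<subseteq> ?E" "D < card Y" for Y
  proof -
    \<comment> \<open>One preimage is chosen for each element of \<open>Y\<close>, since different
      elements of \<open>M\<close> may have the same tensor, for instance in the presence of
      torsion.\<close>
    obtain X where X: "X \<subseteq> carrier M" "inj_on (tensor \<one>\<^bsub>S\<^esub>) X" "Y = tensor \<one>\<^bsub>S\<^esub> ` X"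
      using Y(2) by (auto simp: subset_image_inj)
    with Y have "finite X" "D < card X"
      by (auto simp: card_image finite_image_iff)
    then have "M.lin_dep X"
      using X(1) by (intro bound)
    show ?thesis
      unfolding X(3) using h_inj \<open>finite X\<close> X(1) \<open>M.lin_dep X\<close> X(2) by (rule lin_dep_tensor)
  qed
  let ?P = "\<lambda>Y. Y \<subseteq> ?E \<and> \<not> B.lin_dep Y"
  \<comment> \<open>\<open>dep\<close> speaks of finite sets only; an infinite independent set is
    excluded by passing to a subset with \<open>D + 1\<close> elements.\<close>
  have card: "finite Y \<and> card Y \<le> D" if "?P Y" for Y
  proof (rule ccontr)
    assume "\<not> ?thesis"
    then have "infinite Y \<or> Suc D \<le> card Y" by auto
    then obtain Z where "finite Z" "Z \<subseteq> Y" "card Z = Suc D"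
      using infinite_arbitrarily_large[of Y "Suc D"] obtain_subset_with_card_n[of "Suc D" Y] by blast
    moreover from this have "B.lin_dep Z"
      using that by (intro dep) auto
    ultimately show False
      using B.supset_ld_is_ld[of Z Y] that by blast
  qed
  have "?P {}" by (auto simp: B.lin_dep_def)
  then have "\<exists>Y. finite Y \<and> maximal Y ?P"
    by (intro maximal_exists[of ?P D "{}"] card)
  then obtain Y where Y: "finite Y" "maximal Y ?P"
    by blast
  then have P: "?P Y" and max: "\<And>Z. Y \<subseteq> Z \<Longrightarrow> ?P Z \<Longrightarrow> Z = Y"
    by (auto simp: maximal_def)
  have Y_sub: "Y \<subseteq> carrier B" using P E by blast
  have "?E \<subseteq> B.span Y"
  proof
    fix v assume v: "v \<in> ?E"
    show "v \<in> B.span Y"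
    proof (cases "v \<in> Y")
      case True
      then show ?thesis using B.in_own_span[OF Y_sub] by blast
    next
      case False
      then have "B.lin_dep (Y \<union> {v})"
        using max[of "Y \<union> {v}"] P v by auto
      moreover have "v \<in> carrier B" using v E by blast
      ultimately show ?thesis
        using V.lin_dep_iff_in_span[of Y v] Y_sub P False by simp
    qed
  qed
  then have "B.span ?E \<subseteq> B.span Y"
    by (rule B.span_is_subset) (rule B.span_is_submodule[OF Y_sub])
  then have "B.span Y = carrier B"
    using span_tensor B.span_is_subset2[OF Y_sub] by blast
  then show "V.fin_dim"
    unfolding V.fin_dim_def using Y(1) Y_sub by blast
qed

end

section \<open>Functions given by additive polynomials\<close>

text \<open>Gaussian elimination: each equation is spent on removing at most one unknown, so a
  surplus of unknowns persists. The index sets are arbitrary because in \<open>lin_dep_M\<close>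
  both equations and unknowns are indexed by pairs.\<close>

lemma homogeneous_system:
  fixes a :: "'i \<Rightarrow> 'j \<Rightarrow> 'k::field"
  assumes "finite I" and "finite J" and "card I < card J"
  shows "\<exists>c. (\<exists>j\<in>J. c j \<noteq> 0) \<and> (\<forall>i\<in>I. (\<Sum>j\<in>J. a i j * c j) = 0)"
  using assms
proof (induction I arbitrary: J a rule: finite_induct)
  case empty
  then have "J \<noteq> {}" by auto
  then show ?case by (intro exI[of _ "\<lambda>_. 1"]) auto
next
  case (insert i I)
  show ?case
  proof (cases "\<forall>j\<in>J. a i j = 0")
    case True
    have "card I < card J" using insert by simp
    from insert.IH[OF insert.prems(1) this, of a] True show ?thesis by auto
  next
    case False
    then obtain k where k: "k \<in> J" "a i k \<noteq> 0" by blast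
    have "card I < card (J - {k})" using insert k by (simp add: card_Diff_singleton)
    \<comment> \<open>These coefficients arise from solving equation \<open>i\<close> for the
      unknown \<open>k\<close> and substituting the result into the other equations.\<close>
    from insert.IH[OF _ this, of "\<lambda>l j. a l j - a l k * a i j / a i k"] insert.prems(1)
    obtain c where c: "\<exists>j\<in>J - {k}. c j \<noteq> 0"
      "\<And>l. l \<in> I \<Longrightarrow> (\<Sum>j\<in>J - {k}. (a l j - a l k * a i j / a i k) * c j) = 0"
      by auto
    \<comment> \<open>Equation \<open>i\<close> forces the value \<open>- r\<close> for the
      eliminated unknown \<open>k\<close>.\<close>
    define r where "r = (\<Sum>j\<in>J - {k}. a i j * c j) / a i k"
    let ?c = "c(k := - r)"
    have sum: "(\<Sum>j\<in>J. a l j * ?c j) = (\<Sum>j\<in>J - {k}. a l j * c j) - a l k * r" for l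
    proof -
      have "(\<Sum>j\<in>J - {k}. a l j * ?c j) = (\<Sum>j\<in>J - {k}. a l j * c j)"
        by (rule sum.cong) auto
      then show ?thesis
        by (simp add: sum.remove[OF insert.prems(1) k(1)])
    qed
    have "(\<Sum>j\<in>J. a l j * ?c j) = 0" if "l \<in> insert i I" for l
    proof (cases "l = i")
      case True
      then show ?thesis unfolding sum using k by (simp add: r_def)
    next
      case False
      with that have "(\<Sum>j\<in>J - {k}. (a l j - a l k * a i j / a i k) * c j) = 0" by (intro c) simp
      also have "(\<Sum>j\<in>J - {k}. (a l j - a l k * a i j / a i k) * c j) =
          (\<Sum>j\<in>J - {k}. a l j * c j) - a l k * r"
        by (simp add: r_def left_diff_distrib sum_subtractf sum_distrib_left sum_divide_distrib mult.assoc)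
      finally show ?thesis by (simp only: sum)
    qed
    with c(1) show ?thesis by (intro exI[of _ ?c]) auto
  qed
qed

section \<open>The module \<Lambda>_n and the evaluation of its elements\<close>

lemma Lam_add: "f \<in> Lam q n \<Longrightarrow> g \<in> Lam q n \<Longrightarrow> f + g \<in> Lam q n"
proof -
  have "P + Q \<in> Ktau q" if "P \<in> Ktau q" "Q \<in> Ktau q" for P Q :: "'a poly"
    using that unfolding Ktau_def by force
  then show "f \<in> Lam q n \<Longrightarrow> g \<in> Lam q n \<Longrightarrow> f + g \<in> Lam q n"
    by (auto simp: Lam_def)
qed

lemma Lam_smult: "f \<in> Lam q n \<Longrightarrow> map_vec (Polynomial.smult c) f \<in> Lam q n"
  by (auto simp: Lam_def Ktau_def)

lemma Lam_carrier: "f \<in> Lam q n \<Longrightarrow> f \<in> carrier_vec n"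
  by (simp add: Lam_def)

lemma ev_add: "f \<in> carrier_vec n \<Longrightarrow> g \<in> carrier_vec n \<Longrightarrow> ev (f + g) x = ev f x + ev g x"
  unfolding ev_def by (simp add: sum.distrib)

lemma ev_smult: "f \<in> carrier_vec n \<Longrightarrow> ev (map_vec (Polynomial.smult c) f) x = c * ev f x"
  unfolding ev_def by (simp add: sum_distrib_left)

text \<open>Since \<open>k < q ^ k\<close>, every exponent \<open>q ^ k\<close> up to the degree has
  \<open>k \<le> s\<close>. The ordinary degree is thus a crude bound for the \<tau>-degree, and
  crude bounds suffice below.\<close>

lemma poly_Ktau:
  assumes q: "1 < q" and P: "P \<in> Ktau q" and s: "degree P \<le> s"
  shows "poly P x = (\<Sum>k\<le>s. coeff P (q ^ k) * x ^ (q ^ k))"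
proof -
  have inj: "inj_on (\<lambda>k. q ^ k) {..s}"
    using q by (auto simp: inj_on_def)
  have "(\<Sum>k\<le>s. coeff P (q ^ k) * x ^ (q ^ k)) = (\<Sum>l\<in>(\<lambda>k. q ^ k) ` {..s}. coeff P l * x ^ l)"
    by (simp add: sum.reindex[OF inj])
  also have "\<dots> = (\<Sum>l\<in>{..degree P} \<union> (\<lambda>k. q ^ k) ` {..s}. coeff P l * x ^ l)"
  proof (rule sum.mono_neutral_left)
    show "\<forall>l\<in>{..degree P} \<union> (\<lambda>k. q ^ k) ` {..s} - (\<lambda>k. q ^ k) ` {..s}. coeff P l * x ^ l = 0"
    proof
      fix l assume l: "l \<in> {..degree P} \<union> (\<lambda>k. q ^ k) ` {..s} - (\<lambda>k. q ^ k) ` {..s}"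
      have "k \<le> s" if "l = q ^ k" for k
        using that l s power_gt_expt[of q k] q by auto
      with l have "\<nexists>k. l = q ^ k" by auto
      with P show "coeff P l * x ^ l = 0" by (auto simp: Ktau_def)
    qed
  qed auto
  also have "\<dots> = (\<Sum>l\<le>degree P. coeff P l * x ^ l)"
    by (rule sum.mono_neutral_right) (auto simp: coeff_eq_0)
  finally show ?thesis by (simp add: poly_altdef)
qed

text \<open>The restrictions to \<open>F\<close> of elements of \<open>\<Lambda>\<^sub>n\<close> of \<open>\<tau>\<close>-degree at most \<open>s\<close>; the values
  outside \<open>F\<close> are arbitrary.\<close>

definition additive_fun :: "nat \<Rightarrow> nat \<Rightarrow> 'k::field vec set \<Rightarrow> nat \<Rightarrow> ('k vec \<Rightarrow> 'k) set" where
  "additive_fun q n F s =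
    {\<phi>. \<exists>a. \<forall>x\<in>F. \<phi> x = (\<Sum>i<n. \<Sum>k\<le>s. a i k * (x $ i) ^ (q ^ k))}"

lemma additive_fun_mono:
  assumes "\<phi> \<in> additive_fun q n F s" and "s \<le> s'"
  shows "\<phi> \<in> additive_fun q n F s'"
proof -
  from assms(1) obtain a where a: "\<forall>x\<in>F. \<phi> x = (\<Sum>i<n. \<Sum>k\<le>s. a i k * (x $ i) ^ (q ^ k))"
    by (auto simp: additive_fun_def)
  have "(\<Sum>k\<le>s. a i k * (x $ i) ^ (q ^ k)) =
      (\<Sum>k\<le>s'. (if k \<le> s then a i k else 0) * (x $ i) ^ (q ^ k))" for i and x :: "'a vec"
    using assms(2) by (intro sum.mono_neutral_cong_left) auto
  with a show ?thesis
    unfolding additive_fun_def by (intro CollectI exI[of _ "\<lambda>i k. if k \<le> s then a i k else 0"]) simp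
qed

lemma additive_fun_cong:
  "\<phi> \<in> additive_fun q n F s \<Longrightarrow> (\<And>x. x \<in> F \<Longrightarrow> \<psi> x = \<phi> x) \<Longrightarrow> \<psi> \<in> additive_fun q n F s"
  by (auto simp: additive_fun_def)

lemma additive_fun_zero: "(\<lambda>x. 0) \<in> additive_fun q n F s"
  by (auto simp: additive_fun_def intro!: exI[of _ "\<lambda>_ _. 0"])

lemma additive_fun_add:
  assumes "\<phi> \<in> additive_fun q n F s" and "\<psi> \<in> additive_fun q n F s"
  shows "(\<lambda>x. \<phi> x + \<psi> x) \<in> additive_fun q n F s"
proof -
  from assms obtain a b where
    "\<forall>x\<in>F. \<phi> x = (\<Sum>i<n. \<Sum>k\<le>s. a i k * (x $ i) ^ (q ^ k))"
    "\<forall>x\<in>F. \<psi> x = (\<Sum>i<n. \<Sum>k\<le>s. b i k * (x $ i) ^ (q ^ k))"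
    unfolding additive_fun_def by blast
  then show ?thesis unfolding additive_fun_def
    by (intro CollectI exI[of _ "\<lambda>i k. a i k + b i k"]) (simp add: sum.distrib distrib_right)
qed

lemma additive_fun_smult:
  assumes "\<phi> \<in> additive_fun q n F s"
  shows "(\<lambda>x. c * \<phi> x) \<in> additive_fun q n F s"
proof -
  from assms obtain a where "\<forall>x\<in>F. \<phi> x = (\<Sum>i<n. \<Sum>k\<le>s. a i k * (x $ i) ^ (q ^ k))"
    by (auto simp: additive_fun_def)
  then show ?thesis unfolding additive_fun_def
    by (intro CollectI exI[of _ "\<lambda>i k. c * a i k"]) (simp add: sum_distrib_left mult.assoc)
qed

lemma additive_fun_sum:
  assumes "\<And>i. i \<in> I \<Longrightarrow> \<phi> i \<in> additive_fun q n F s"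
  shows "(\<lambda>x. \<Sum>i\<in>I. \<phi> i x) \<in> additive_fun q n F s"
  using assms
  by (induction I rule: infinite_finite_induct) (simp_all add: additive_fun_zero additive_fun_add)

lemma additive_fun_monomial:
  assumes "i < n" and "k \<le> s"
  shows "(\<lambda>x. (x $ i) ^ (q ^ k)) \<in> additive_fun q n F s"
proof -
  have "(\<Sum>j<n. \<Sum>l\<le>s. (if j = i \<and> l = k then 1 else 0) * (x $ j) ^ (q ^ l)) = (x $ i) ^ (q ^ k)"
    for x :: "'a vec"
  proof -
    have "(\<Sum>j<n. \<Sum>l\<le>s. (if j = i \<and> l = k then 1 else 0) * (x $ j) ^ (q ^ l)) =
        (\<Sum>j<n. if j = i then (x $ i) ^ (q ^ k) else 0)"
      using assms(2) by (intro sum.cong) (auto simp: if_distrib[of "\<lambda>u. u * _"] cong: if_cong)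
    then show ?thesis using assms(1) by simp
  qed
  then show ?thesis
    unfolding additive_fun_def by (intro CollectI exI[of _ "\<lambda>j l. if j = i \<and> l = k then 1 else 0"]) simp
qed

lemma ev_in_additive_fun:
  assumes q: "1 < q" and f: "f \<in> Lam q n"
  obtains s where "ev f \<in> additive_fun q n F s"
proof
  \<comment> \<open>A sum of degrees, rather than a maximum, serves as common bound; it also covers
    \<open>n = 0\<close>.\<close>
  define s where "s = (\<Sum>i<n. degree (f $ i))"
  have "degree (f $ i) \<le> s" if "i < n" for i
    unfolding s_def using that member_le_sum[of i "{..<n}" "\<lambda>i. degree (f $ i)"] by auto
  then have "ev f x = (\<Sum>i<n. \<Sum>k\<le>s. coeff (f $ i) (q ^ k) * (x $ i) ^ (q ^ k))" for x
    using f unfolding ev_def Lam_def by (auto intro!: sum.cong poly_Ktau[OF q])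
  then show "ev f \<in> additive_fun q n F s"
    unfolding additive_fun_def by (intro CollectI exI[of _ "\<lambda>i k. coeff (f $ i) (q ^ k)"]) simp
qed

lemma additive_fun_ev:
  assumes "\<phi> \<in> additive_fun q n F s"
  obtains f where "f \<in> Lam q n" and "\<And>x. x \<in> F \<Longrightarrow> ev f x = \<phi> x"
proof -
  from assms obtain a where a: "\<forall>x\<in>F. \<phi> x = (\<Sum>i<n. \<Sum>k\<le>s. a i k * (x $ i) ^ (q ^ k))"
    by (auto simp: additive_fun_def)
  define f where "f = vec n (\<lambda>i. \<Sum>k\<le>s. monom (a i k) (q ^ k))"
  have "(\<Sum>k\<le>s. monom (b k) (q ^ k)) \<in> Ktau q" for b :: "nat \<Rightarrow> 'a"
  proof -
    have "\<exists>k. l = q ^ k" if "coeff (\<Sum>k\<le>s. monom (b k) (q ^ k)) l \<noteq> 0" for l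
    proof (rule ccontr)
      assume "\<nexists>k. l = q ^ k"
      then have "coeff (\<Sum>k\<le>s. monom (b k) (q ^ k)) l = 0"
        by (auto simp: coeff_sum intro!: sum.neutral)
      with that show False by simp
    qed
    then show ?thesis by (simp add: Ktau_def)
  qed
  then have "f \<in> Lam q n" by (simp add: f_def Lam_def)
  moreover have "ev f x = \<phi> x" if "x \<in> F" for x
    using a that by (simp add: f_def ev_def poly_sum poly_monom)
  ultimately show ?thesis by (rule that)
qed

text \<open>Raising to the power \<open>q ^ k\<close> is an iterate of the Frobenius map, hence
  additive and multiplicative: coefficients are raised to that power, and each exponent
  \<open>q ^ l\<close> becomes \<open>q ^ (l + k)\<close>.\<close>

lemma additive_fun_power:
  fixes F :: "'k::field vec set"
  assumes p: "prime p" "CHAR('k) = p" "q = p ^ e" and \<phi>: "\<phi> \<in> additive_fun q n F d"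
  shows "(\<lambda>x. \<phi> x ^ (q ^ k)) \<in> additive_fun q n F (d + k)"
proof -
  from \<phi> obtain a where a: "\<forall>x\<in>F. \<phi> x = (\<Sum>i<n. \<Sum>l\<le>d. a i l * (x $ i) ^ (q ^ l))"
    by (auto simp: additive_fun_def)
  have qk: "q ^ k = CHAR('k) ^ (e * k)" using p by (simp add: power_mult)
  have "\<phi> x ^ (q ^ k) = (\<Sum>i<n. \<Sum>l\<le>d. a i l ^ (q ^ k) * (x $ i) ^ (q ^ (l + k)))" if "x \<in> F" for x
    using a that p unfolding qk
    by (simp add: freshmans_dream_sum' power_mult_distrib)
       (simp add: qk[symmetric] power_add power_mult[symmetric] mult.commute)
  moreover have "(\<lambda>x. \<Sum>i<n. \<Sum>l\<le>d. a i l ^ (q ^ k) * (x $ i) ^ (q ^ (l + k))) \<in> additive_fun q n F (d + k)"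
    by (intro additive_fun_sum additive_fun_smult additive_fun_monomial) auto
  ultimately show ?thesis by (rule additive_fun_cong[rotated])
qed

text \<open>Substituting \<open>t\<close> into a monomial gives the \<open>q ^ k\<close>-th power of
  a coordinate of \<open>t\<close>, of \<tau>-degree at most \<open>d + k\<close>. As
  \<open>t\<close> preserves \<open>F\<close>, the expansion of \<open>\<phi>\<close> is valid at
  \<open>t x\<close>.\<close>

lemma additive_fun_comp:
  fixes F :: "'k::field vec set"
  assumes p: "prime p" "CHAR('k) = p" "q = p ^ e" and \<phi>: "\<phi> \<in> additive_fun q n F s"
    and t: "\<And>x. x \<in> F \<Longrightarrow> t x \<in> F" "\<And>j. j < n \<Longrightarrow> (\<lambda>x. t x $ j) \<in> additive_fun q n F d"
  shows "(\<lambda>x. \<phi> (t x)) \<in> additive_fun q n F (s + d)"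
proof -
  from \<phi> obtain a where a: "\<forall>x\<in>F. \<phi> x = (\<Sum>i<n. \<Sum>k\<le>s. a i k * (x $ i) ^ (q ^ k))"
    by (auto simp: additive_fun_def)
  have "(\<lambda>x. t x $ i ^ q ^ k) \<in> additive_fun q n F (s + d)" if "i < n" "k \<le> s" for i k
    using that by (intro additive_fun_mono[OF additive_fun_power[OF p t(2)]]) auto
  then have "(\<lambda>x. \<Sum>i<n. \<Sum>k\<le>s. a i k * (t x $ i) ^ (q ^ k)) \<in> additive_fun q n F (s + d)"
    by (intro additive_fun_sum additive_fun_smult) auto
  then show ?thesis by (rule additive_fun_cong) (use a t(1) in auto)
qed

section \<open>The \<open>K[T]\<close>-module \<open>K{F}\<close>\<close>

locale A_structure =
  fixes p e q n :: nat and \<delta> :: "'k::field poly \<Rightarrow> 'k"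
    and F :: "'k vec set" and \<Phi> :: "'k poly \<Rightarrow> 'k vec \<Rightarrow> 'k vec"
  assumes p: "prime p" "CHAR('k) = p" and e: "e > 0" and q: "q = p ^ e"
    and A_module: "A_module_structure q n \<delta> F \<Phi>"
begin

abbreviation "V \<equiv> KF_space q n F"
abbreviation "M \<equiv> KF_module q n F \<Phi>"

lemma q_gt_1: "1 < q"
  using one_less_power[OF prime_gt_1_nat[OF p(1)] e] q by simp

section \<open>Elements of K{F} as classes of functions on F\<close>

definition funs :: "('k vec \<Rightarrow> 'k) set" where
  "funs = (\<Union>s. additive_fun q n F s)"

text \<open>The coset of a function in K{F}, described through values so that no representing
  polynomial has to be chosen. Values of \<open>\<phi>\<close> outside \<open>F\<close> have no
  influence.\<close>

definition cls :: "('k vec \<Rightarrow> 'k) \<Rightarrow> 'k poly vec set" where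
  "cls \<phi> = {f \<in> Lam q n. \<forall>x\<in>F. ev f x = \<phi> x}"

lemma funs_add: "\<phi> \<in> funs \<Longrightarrow> \<psi> \<in> funs \<Longrightarrow> (\<lambda>x. \<phi> x + \<psi> x) \<in> funs"
proof -
  assume "\<phi> \<in> funs" "\<psi> \<in> funs"
  then obtain s s' where "\<phi> \<in> additive_fun q n F s" "\<psi> \<in> additive_fun q n F s'"
    by (auto simp: funs_def)
  then have "\<phi> \<in> additive_fun q n F (max s s')" "\<psi> \<in> additive_fun q n F (max s s')"
    by (auto elim: additive_fun_mono)
  then show ?thesis unfolding funs_def by (blast intro: additive_fun_add)
qed

lemma funs_smult: "\<phi> \<in> funs \<Longrightarrow> (\<lambda>x. c * \<phi> x) \<in> funs"
  unfolding funs_def by (blast intro: additive_fun_smult)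

lemma funs_zero: "(\<lambda>x. 0) \<in> funs"
  unfolding funs_def by (blast intro: additive_fun_zero)

lemma funs_sum: "(\<And>i. i \<in> I \<Longrightarrow> \<phi> i \<in> funs) \<Longrightarrow> (\<lambda>x. \<Sum>i\<in>I. \<phi> i x) \<in> funs"
  by (induction I rule: infinite_finite_induct) (simp_all add: funs_zero funs_add)

lemma ev_in_funs:
  assumes "f \<in> Lam q n"
  shows "ev f \<in> funs"
proof -
  obtain s where "ev f \<in> additive_fun q n F s"
    using q_gt_1 assms by (rule ev_in_additive_fun)
  then show ?thesis by (auto simp: funs_def)
qed

lemma funs_ev:
  assumes "\<phi> \<in> funs"
  obtains f where "f \<in> cls \<phi>"
proof -
  from assms obtain s where "\<phi> \<in> additive_fun q n F s" by (auto simp: funs_def)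
  then obtain f where "f \<in> Lam q n" "\<And>x. x \<in> F \<Longrightarrow> ev f x = \<phi> x" by (rule additive_fun_ev) blast
  then show ?thesis by (intro that[of f]) (simp add: cls_def)
qed

text \<open>A common representative recovers the values of both functions on \<open>F\<close>.
  Membership in \<open>funs\<close> provides one; functions without representatives all have the
  empty class.\<close>

lemma cls_eq_iff:
  assumes "\<phi> \<in> funs"
  shows "cls \<phi> = cls \<psi> \<longleftrightarrow> (\<forall>x\<in>F. \<phi> x = \<psi> x)"
proof
  assume eq: "cls \<phi> = cls \<psi>"
  obtain f where f: "f \<in> cls \<phi>" using assms by (rule funs_ev)
  with eq have "f \<in> cls \<psi>" by simp
  with f show "\<forall>x\<in>F. \<phi> x = \<psi> x" by (auto simp: cls_def)
qed (simp add: cls_def)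

text \<open>Two elements of \<Lambda>_n define the same function on \<open>F\<close> exactly if
  their difference vanishes there.\<close>

lemma coset_eq_cls:
  assumes f: "f \<in> Lam q n"
  shows "vanishing q n F +>\<^bsub>Lam_module q n\<^esub> f = cls (ev f)"
proof -
  have "g \<in> (\<lambda>h. h + f) ` vanishing q n F" if g: "g \<in> cls (ev f)" for g
  proof (rule image_eqI[of _ _ "g - f"])
    have L: "g \<in> Lam q n" using g by (simp add: cls_def)
    note c = Lam_carrier[OF f] Lam_carrier[OF L]
    from c show "g = g - f + f" by auto
    show "g - f \<in> vanishing q n F"
      using f g L by (simp add: vanishing_def cls_def Lam_diff ev_diff[OF c(2,1)])
  qed
  moreover have "h + f \<in> cls (ev f)" if "h \<in> vanishing q n F" for h
    using that f by (auto simp: vanishing_def cls_def Lam_add ev_add[OF Lam_carrier[of _ q n] Lam_carrier[of _ q n]])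
  ultimately show ?thesis
    by (auto simp: a_r_coset_def r_coset_def Lam_module_def)
qed

lemma carrier_V: "carrier V = cls ` funs"
proof -
  have "carrier V = {cls (ev f) | f. f \<in> Lam q n}"
  proof -
    have "carrier V = (\<lambda>f. vanishing q n F +>\<^bsub>Lam_module q n\<^esub> f) ` Lam q n"
      by (auto simp: KF_space_def quot_module_def A_RCOSETS_def RCOSETS_def a_r_coset_def Lam_module_def)
    also have "\<dots> = (\<lambda>f. cls (ev f)) ` Lam q n"
      using coset_eq_cls by (rule image_cong[OF refl])
    finally show ?thesis by blast
  qed
  also have "\<dots> = cls ` funs"
  proof
    show "{cls (ev f) | f. f \<in> Lam q n} \<subseteq> cls ` funs"
      using ev_in_funs by auto
    show "cls ` funs \<subseteq> {cls (ev f) | f. f \<in> Lam q n}"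
    proof
      fix C assume "C \<in> cls ` funs"
      then obtain \<phi> where \<phi>: "\<phi> \<in> funs" "C = cls \<phi>" by blast
      obtain f where "f \<in> cls \<phi>" using \<phi>(1) by (rule funs_ev)
      then have "f \<in> Lam q n" "cls \<phi> = cls (ev f)" by (auto simp: cls_def)
      with \<phi> show "C \<in> {cls (ev f) | f. f \<in> Lam q n}" by blast
    qed
  qed
  finally show ?thesis .
qed

lemma zero_V: "\<zero>\<^bsub>V\<^esub> = cls (\<lambda>x. 0)"
  by (simp add: KF_space_def quot_module_def vanishing_def cls_def)

text \<open>Cosets are added as sets. For the inclusion from right to left, any representative
  \<open>f\<close> of \<open>\<phi>\<close> splits \<open>h\<close> as
  \<open>f + (h - f)\<close>.\<close>

lemma cls_add:
  assumes "\<phi> \<in> funs" and "\<psi> \<in> funs"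
  shows "cls \<phi> \<oplus>\<^bsub>V\<^esub> cls \<psi> = cls (\<lambda>x. \<phi> x + \<psi> x)"
proof -
  have "cls \<phi> \<oplus>\<^bsub>V\<^esub> cls \<psi> = {f + g | f g. f \<in> cls \<phi> \<and> g \<in> cls \<psi>}"
    by (auto simp: KF_space_def quot_module_def Lam_module_def set_add_def set_mult_def)
  also have "\<dots> = cls (\<lambda>x. \<phi> x + \<psi> x)"
  proof (intro equalityI subsetI)
    fix h assume h: "h \<in> cls (\<lambda>x. \<phi> x + \<psi> x)"
    obtain f where f: "f \<in> cls \<phi>" using assms(1) by (rule funs_ev)
    have L: "f \<in> Lam q n" "h \<in> Lam q n" using f h by (auto simp: cls_def)
    note c = Lam_carrier[OF L(1)] Lam_carrier[OF L(2)]
    from c have "h = f + (h - f)" by auto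
    moreover have "h - f \<in> cls \<psi>"
      using f h L by (simp add: cls_def Lam_diff ev_diff[OF c(2,1)])
    ultimately show "h \<in> {f + g | f g. f \<in> cls \<phi> \<and> g \<in> cls \<psi>}" using f by blast
  qed (auto simp: cls_def Lam_add ev_add[OF Lam_carrier[of _ q n] Lam_carrier[of _ q n]])
  finally show ?thesis .
qed

text \<open>The summand \<open>vanishing q n F\<close> in \<open>quot_module\<close> makes the
  result a full coset also for \<open>c = 0\<close>, where multiplication alone maps a class to the
  zero vector.\<close>

lemma cls_smult:
  assumes "\<phi> \<in> funs"
  shows "c \<odot>\<^bsub>V\<^esub> cls \<phi> = cls (\<lambda>x. c * \<phi> x)"
proof -
  let ?m = "map_vec (Polynomial.smult c) :: 'k poly vec \<Rightarrow> 'k poly vec"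
  have "c \<odot>\<^bsub>V\<^esub> cls \<phi> = {h + ?m f | h f. h \<in> vanishing q n F \<and> f \<in> cls \<phi>}"
    by (auto simp: KF_space_def quot_module_def Lam_module_def set_add_def set_mult_def)
  also have "\<dots> = cls (\<lambda>x. c * \<phi> x)"
  proof (intro equalityI subsetI)
    fix h assume h: "h \<in> cls (\<lambda>x. c * \<phi> x)"
    obtain f where f: "f \<in> cls \<phi>" using assms(1) by (rule funs_ev)
    have L: "f \<in> Lam q n" "?m f \<in> Lam q n" "h \<in> Lam q n"
      using f h by (auto simp: cls_def Lam_smult)
    note c = Lam_carrier[OF L(1)] Lam_carrier[OF L(2)] Lam_carrier[OF L(3)]
    from c have "h = (h - ?m f) + ?m f" by auto
    moreover have "h - ?m f \<in> vanishing q n F"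
      using f h L by (simp add: cls_def vanishing_def Lam_diff ev_diff[OF c(3,2)] ev_smult[OF c(1)])
    ultimately show "h \<in> {h + ?m f | h f. h \<in> vanishing q n F \<and> f \<in> cls \<phi>}" using f by blast
  qed (auto simp: cls_def vanishing_def Lam_add Lam_smult ev_smult[OF Lam_carrier[of _ q n]]
      ev_add[OF Lam_carrier[of _ q n] Lam_carrier[of _ q n]])
  finally show ?thesis .
qed

text \<open>\<open>KF_space\<close> and \<open>KF_module\<close> are records of different types with the same underlying group.\<close>

definition cls_group :: "('r, 'k poly vec set) module \<Rightarrow> bool" where
  "cls_group U \<longleftrightarrow> carrier U = cls ` funs \<and> \<zero>\<^bsub>U\<^esub> = cls (\<lambda>x. 0) \<and>
    (\<forall>\<phi>\<in>funs. \<forall>\<psi>\<in>funs. cls \<phi> \<oplus>\<^bsub>U\<^esub> cls \<psi> = cls (\<lambda>x. \<phi> x + \<psi> x))"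

lemma cls_group_V: "cls_group V"
  by (simp add: cls_group_def carrier_V zero_V cls_add)

lemma cls_group_M: "cls_group M"
  by (simp add: cls_group_def KF_module_def carrier_V zero_V cls_add)

lemma abelian_cls_group:
  assumes "cls_group U"
  shows "abelian_group U"
proof (rule abelian_groupI)
  have U: "carrier U = cls ` funs" "\<zero>\<^bsub>U\<^esub> = cls (\<lambda>x. 0)"
    "\<And>\<phi> \<psi>. \<phi> \<in> funs \<Longrightarrow> \<psi> \<in> funs \<Longrightarrow> cls \<phi> \<oplus>\<^bsub>U\<^esub> cls \<psi> = cls (\<lambda>x. \<phi> x + \<psi> x)"
    using assms by (auto simp: cls_group_def)
  show "\<zero>\<^bsub>U\<^esub> \<in> carrier U" using funs_zero by (simp add: U)
  fix x assume "x \<in> carrier U"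
  then obtain \<phi> where x: "\<phi> \<in> funs" "x = cls \<phi>" by (auto simp: U)
  show "\<zero>\<^bsub>U\<^esub> \<oplus>\<^bsub>U\<^esub> x = x" using x funs_zero by (simp add: U)
  have "cls (\<lambda>x. - 1 * \<phi> x) \<oplus>\<^bsub>U\<^esub> x = \<zero>\<^bsub>U\<^esub>"
    using x funs_smult[of \<phi> "- 1"] by (simp add: U(3)) (simp add: U)
  then show "\<exists>y\<in>carrier U. y \<oplus>\<^bsub>U\<^esub> x = \<zero>\<^bsub>U\<^esub>"
    using funs_smult[OF x(1)] unfolding U(1) by blast
  fix y assume "y \<in> carrier U"
  then obtain \<psi> where y: "\<psi> \<in> funs" "y = cls \<psi>" by (auto simp: U)
  show "x \<oplus>\<^bsub>U\<^esub> y \<in> carrier U" using x y by (simp add: U funs_add)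
  show "x \<oplus>\<^bsub>U\<^esub> y = y \<oplus>\<^bsub>U\<^esub> x" using x y by (simp add: U add.commute)
  fix z assume "z \<in> carrier U"
  then obtain \<chi> where z: "\<chi> \<in> funs" "z = cls \<chi>" by (auto simp: U)
  show "x \<oplus>\<^bsub>U\<^esub> y \<oplus>\<^bsub>U\<^esub> z = x \<oplus>\<^bsub>U\<^esub> (y \<oplus>\<^bsub>U\<^esub> z)"
    using x y z by (simp add: U funs_add add.assoc)
qed

lemma finsum_cls:
  assumes "cls_group U" and "\<And>i. i \<in> I \<Longrightarrow> \<phi> i \<in> funs" and "finite I"
  shows "finsum U (\<lambda>i. cls (\<phi> i)) I = cls (\<lambda>x. \<Sum>i\<in>I. \<phi> i x)"
proof -
  interpret U: abelian_group U using assms(1) by (rule abelian_cls_group)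
  have U: "carrier U = cls ` funs" "\<zero>\<^bsub>U\<^esub> = cls (\<lambda>x. 0)"
    "\<And>\<phi> \<psi>. \<phi> \<in> funs \<Longrightarrow> \<psi> \<in> funs \<Longrightarrow> cls \<phi> \<oplus>\<^bsub>U\<^esub> cls \<psi> = cls (\<lambda>x. \<phi> x + \<psi> x)"
    using assms(1) by (auto simp: cls_group_def)
  show ?thesis using assms(3,2)
  proof (induction I rule: finite_induct)
    case empty
    then show ?case by (simp add: U)
  next
    case (insert i I)
    then have "finsum U (\<lambda>i. cls (\<phi> i)) (insert i I) = cls (\<phi> i) \<oplus>\<^bsub>U\<^esub> finsum U (\<lambda>i. cls (\<phi> i)) I"
      by (intro U.finsum_insert) (auto simp: U)
    with insert show ?case by (simp add: U funs_sum)
  qed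
qed

section \<open>The action of T and its effect on the \<tau>-degree\<close>

definition t :: "'k vec \<Rightarrow> 'k vec" where
  "t = \<Phi> (monom 1 1)"

lemma monom_in_A: "monom 1 i \<in> carrier (A_ring q)"
  using q_gt_1 by (auto simp: A_ring_def Fq_def)

lemma \<Phi>_hom: "\<Phi> \<in> Ring.ring_hom (A_ring q) (End_ring q n F)"
  using A_module by (simp add: A_module_structure_def)

lemma t_morphism: "t \<in> q_morphisms q n n F F"
  using ring_hom_closed[OF \<Phi>_hom monom_in_A[of 1]] by (simp add: t_def End_ring_def)

lemma t_closed: "x \<in> F \<Longrightarrow> t x \<in> F"
  using t_morphism by (auto simp: q_morphisms_def)

lemma t_funpow_closed: "x \<in> F \<Longrightarrow> (t ^^ i) x \<in> F"
  by (induction i) (simp_all add: t_closed)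

text \<open>\<open>\<Phi>\<close> is multiplicative and multiplication in \<open>End_ring\<close> is
  composition of maps restricted to \<open>F\<close>, so T^i acts as an iterate of \<open>t\<close>
  at points of \<open>F\<close>.\<close>

lemma \<Phi>_monom: "x \<in> F \<Longrightarrow> \<Phi> (monom 1 i) x = (t ^^ i) x"
proof (induction i)
  case 0
  have "\<Phi> \<one>\<^bsub>A_ring q\<^esub> = \<one>\<^bsub>End_ring q n F\<^esub>"
    using \<Phi>_hom by (rule ring_hom_one)
  with 0 show ?case by (simp add: A_ring_def End_ring_def monom_eq_1)
next
  case (Suc i)
  have "\<Phi> (monom 1 1 \<otimes>\<^bsub>A_ring q\<^esub> monom 1 i) = \<Phi> (monom 1 1) \<otimes>\<^bsub>End_ring q n F\<^esub> \<Phi> (monom 1 i)"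
    using \<Phi>_hom by (rule ring_hom_mult) (rule monom_in_A)+
  then have "\<Phi> (monom 1 (Suc i)) = compose F t (\<Phi> (monom 1 i))"
    by (simp add: A_ring_def End_ring_def mult_monom t_def)
  with Suc show ?case by (simp add: compose_def)
qed

text \<open>Finitely many elements of \<Lambda>_n represent \<open>t\<close>, so their
  \<tau>-degrees have a common bound. This \<open>d\<close> is the one in the final dimension bound
  \<open>n * d\<close>.\<close>

lemma t_degree: obtains d where "\<And>j. j < n \<Longrightarrow> (\<lambda>x. t x $ j) \<in> additive_fun q n F d"
proof -
  obtain g where g: "represents q n n F g t"
    using t_morphism by (auto simp: q_morphisms_def)
  have "\<exists>s. ev (g j) \<in> additive_fun q n F s" if "j < n" for j
  proof -
    have "g j \<in> Lam q n" using g that by (simp add: represents_def)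
    then have "ev (g j) \<in> funs" by (rule ev_in_funs)
    then show ?thesis by (simp add: funs_def)
  qed
  then obtain s where s: "\<And>j. j < n \<Longrightarrow> ev (g j) \<in> additive_fun q n F (s j)" by metis
  have "(\<lambda>x. t x $ j) \<in> additive_fun q n F (\<Sum>j<n. s j)" if "j < n" for j
  proof (rule additive_fun_cong)
    show "ev (g j) \<in> additive_fun q n F (\<Sum>j<n. s j)"
      using that by (intro additive_fun_mono[OF s]) (auto intro: member_le_sum)
    show "t x $ j = ev (g j) x" if "x \<in> F" for x
      using g \<open>j < n\<close> that by (simp add: represents_def)
  qed
  then show ?thesis by (rule that)
qed

text \<open>Each further application of \<open>t\<close> raises the \<tau>-degree by at most
  \<open>d\<close>. The growth is linear in \<open>i\<close>, which is what the dimension count in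
  \<open>lin_dep_M\<close> relies on.\<close>

lemma additive_fun_funpow:
  assumes "\<And>j. j < n \<Longrightarrow> (\<lambda>x. t x $ j) \<in> additive_fun q n F d" and "\<phi> \<in> additive_fun q n F s"
  shows "(\<lambda>x. \<phi> ((t ^^ i) x)) \<in> additive_fun q n F (s + i * d)"
proof (induction i)
  case (Suc i)
  have "(\<lambda>x. \<phi> ((t ^^ i) (t x))) \<in> additive_fun q n F (s + i * d + d)"
    using p q Suc t_closed assms(1) by (rule additive_fun_comp)
  moreover have "s + i * d + d = s + Suc i * d" by simp
  ultimately show ?case by (simp only: funpow_Suc_right o_apply)
qed (simp add: assms)

lemma funs_funpow: "\<phi> \<in> funs \<Longrightarrow> (\<lambda>x. \<phi> ((t ^^ i) x)) \<in> funs"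
proof -
  assume "\<phi> \<in> funs"
  then obtain s where s: "\<phi> \<in> additive_fun q n F s" by (auto simp: funs_def)
  obtain d where "\<And>j. j < n \<Longrightarrow> (\<lambda>x. t x $ j) \<in> additive_fun q n F d" by (rule t_degree) blast
  from additive_fun_funpow[OF this s] show ?thesis unfolding funs_def by blast
qed

text \<open>All representatives of the class agree at the points
  \<open>\<Phi> (monom 1 i) x\<close>, which lie in \<open>F\<close>, so the choice of
  \<open>f\<close> inside \<open>A_act\<close> is immaterial. One representative must exist for the
  result to be nonempty.\<close>

lemma A_act_cls:
  assumes "\<phi> \<in> funs"
  shows "A_act q n F \<Phi> (monom 1 i) (cls \<phi>) = cls (\<lambda>x. \<phi> ((t ^^ i) x))"
proof -
  obtain f where f: "f \<in> cls \<phi>" using assms by (rule funs_ev)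
  have "ev f (\<Phi> (monom 1 i) x) = \<phi> ((t ^^ i) x)" if "f \<in> cls \<phi>" "x \<in> F" for f x
    using that t_funpow_closed by (simp add: cls_def \<Phi>_monom)
  with f show ?thesis unfolding A_act_def cls_def[of "\<lambda>x. \<phi> ((t ^^ i) x)"] by auto
qed

section \<open>The action of K[T] on functions and the resulting module\<close>

definition act :: "'k poly \<Rightarrow> ('k vec \<Rightarrow> 'k) \<Rightarrow> 'k vec \<Rightarrow> 'k" where
  "act P \<phi> x = (\<Sum>i\<le>degree P. coeff P i * \<phi> ((t ^^ i) x))"

lemma act_upto: "degree P \<le> N \<Longrightarrow> act P \<phi> x = (\<Sum>i\<le>N. coeff P i * \<phi> ((t ^^ i) x))"
  unfolding act_def by (rule sum.mono_neutral_left) (auto simp: coeff_eq_0)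

lemma act_0 [simp]: "act 0 \<phi> x = 0"
  by (simp add: act_def)

text \<open>Horner's scheme: T acts by precomposition with \<open>t\<close>. Together with
  \<open>act_0\<close> it allows induction on the polynomial.\<close>

lemma act_pCons [simp]: "act (pCons c P) \<phi> x = c * \<phi> x + act P \<phi> (t x)"
proof -
  have "act (pCons c P) \<phi> x = (\<Sum>i\<le>Suc (degree P). coeff (pCons c P) i * \<phi> ((t ^^ i) x))"
    by (rule act_upto) (rule degree_pCons_le)
  also have "\<dots> = c * \<phi> x + act P \<phi> (t x)"
    by (simp only: sum.atMost_Suc_shift act_def) (simp add: funpow_Suc_right del: funpow.simps(2))
  finally show ?thesis .
qed

lemma act_add: "act (P + Q) \<phi> x = act P \<phi> x + act Q \<phi> x"
proof -
  let ?N = "max (degree P) (degree Q)"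
  have "degree (P + Q) \<le> ?N" by (rule degree_add_le_max)
  then show ?thesis
    by (simp add: act_upto[of _ ?N] distrib_right sum.distrib)
qed

lemma act_smult: "act (Polynomial.smult c P) \<phi> x = c * act P \<phi> x"
  by (simp add: act_upto[OF degree_smult_le] act_def sum_distrib_left mult.assoc)

text \<open>The induction follows (c + T P) Q = c Q + T (P Q). The point \<open>x\<close> is
  generalised because T moves the argument to \<open>t x\<close>.\<close>

lemma act_mult: "act (P * Q) \<phi> x = act P (act Q \<phi>) x"
  by (induction P arbitrary: x) (simp_all add: act_add act_smult)

lemma act_fun_add: "act P (\<lambda>x. \<phi> x + \<psi> x) x = act P \<phi> x + act P \<psi> x"
  by (simp add: act_def distrib_left sum.distrib)

lemma act_closed: "\<phi> \<in> funs \<Longrightarrow> act P \<phi> \<in> funs"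
  unfolding act_def by (intro funs_sum funs_smult funs_funpow)

lemma smult_M:
  assumes "\<phi> \<in> funs"
  shows "P \<odot>\<^bsub>M\<^esub> cls \<phi> = cls (act P \<phi>)"
proof -
  have "P \<odot>\<^bsub>M\<^esub> cls \<phi> = finsum V (\<lambda>i. cls (\<lambda>x. coeff P i * \<phi> ((t ^^ i) x))) {..degree P}"
    using assms by (simp add: KF_module_def A_act_cls cls_smult funs_funpow)
  also have "\<dots> = cls (act P \<phi>)"
    using assms unfolding act_def by (intro finsum_cls[OF cls_group_V] funs_smult funs_funpow) auto
  finally show ?thesis .
qed

lemma carrier_M: "carrier M = cls ` funs" and zero_M: "\<zero>\<^bsub>M\<^esub> = cls (\<lambda>x. 0)"
  and add_M: "\<phi> \<in> funs \<Longrightarrow> \<psi> \<in> funs \<Longrightarrow> cls \<phi> \<oplus>\<^bsub>M\<^esub> cls \<psi> = cls (\<lambda>x. \<phi> x + \<psi> x)"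
  using cls_group_M by (auto simp: cls_group_def)

lemma module_M: "Module.module class_ring M"
proof (rule moduleI)
  show "cring (class_ring :: 'k poly ring)" by (rule class_cring.is_cring)
  show "abelian_group M" using cls_group_M by (rule abelian_cls_group)
  fix x assume "x \<in> carrier M"
  then obtain \<phi> where x: "\<phi> \<in> funs" "x = cls \<phi>" by (auto simp: carrier_M)
  have "act 1 \<phi> = \<phi>" by (simp add: act_def fun_eq_iff)
  then show "\<one>\<^bsub>class_ring\<^esub> \<odot>\<^bsub>M\<^esub> x = x" using x by (simp add: smult_M)
  fix P :: "'k poly"
  show "P \<odot>\<^bsub>M\<^esub> x \<in> carrier M" using x by (simp add: smult_M carrier_M act_closed)
  {
    fix y assume "y \<in> carrier M"
    then obtain \<psi> where y: "\<psi> \<in> funs" "y = cls \<psi>" by (auto simp: carrier_M)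
    show "P \<odot>\<^bsub>M\<^esub> (x \<oplus>\<^bsub>M\<^esub> y) = P \<odot>\<^bsub>M\<^esub> x \<oplus>\<^bsub>M\<^esub> P \<odot>\<^bsub>M\<^esub> y"
      using x y by (simp add: smult_M add_M act_closed funs_add act_fun_add cls_eq_iff)
  }
  fix Q :: "'k poly"
  show "(P \<oplus>\<^bsub>class_ring\<^esub> Q) \<odot>\<^bsub>M\<^esub> x = P \<odot>\<^bsub>M\<^esub> x \<oplus>\<^bsub>M\<^esub> Q \<odot>\<^bsub>M\<^esub> x"
    using x by (simp add: smult_M add_M act_closed act_add cls_eq_iff)
  show "(P \<otimes>\<^bsub>class_ring\<^esub> Q) \<odot>\<^bsub>M\<^esub> x = P \<odot>\<^bsub>M\<^esub> (Q \<odot>\<^bsub>M\<^esub> x)"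
    using x by (simp add: smult_M act_closed act_mult cls_eq_iff)
qed

sublocale M: Module.module class_ring M
  by (rule module_M)

text \<open>The unknowns are the coefficients \<open>c (x, j)\<close> of the elements T^j x, with
  one equation for each monomial X_i^(q^k). A solution cancels all coefficients of the chosen
  expansions, which forces the combination to vanish on \<open>F\<close>.\<close>

lemma lin_dep_M:
  assumes d: "\<And>j. j < n \<Longrightarrow> (\<lambda>x. t x $ j) \<in> additive_fun q n F d"
    and X: "finite X" "X \<subseteq> carrier M" "n * d < card X"
  shows "M.lin_dep X"
proof -
  have "\<forall>x\<in>X. \<exists>\<phi>. \<phi> \<in> funs \<and> x = cls \<phi>"
    using X(2) by (auto simp: carrier_M)
  then obtain \<phi> where \<phi>_cls: "\<forall>x\<in>X. \<phi> x \<in> funs \<and> x = cls (\<phi> x)"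
    by (rule bchoice[THEN exE])
  then have \<phi>_funs: "\<phi> x \<in> funs" and cls: "x = cls (\<phi> x)" if "x \<in> X" for x
    using that by auto
  have "\<forall>x\<in>X. \<exists>s. \<phi> x \<in> additive_fun q n F s"
    using \<phi>_funs by (auto simp: funs_def)
  then obtain r where r: "\<forall>x\<in>X. \<phi> x \<in> additive_fun q n F (r x)"
    by (rule bchoice[THEN exE])
  define s where "s = (\<Sum>x\<in>X. r x)"
  have \<phi>_s: "\<phi> x \<in> additive_fun q n F s" if "x \<in> X" for x
    using that X(1) unfolding s_def by (intro additive_fun_mono[OF bspec[OF r]]) (auto intro: member_le_sum)
  \<comment> \<open>The elements \<open>T^j x\<close> with \<open>x \<in> X\<close>, \<open>j \<le> N\<close> lie in a space of dimension \<open>n (s + N d + 1)\<close>;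
    there are at least \<open>(n d + 1) (N + 1)\<close> of them, which is more for this \<open>N\<close>.\<close>
  define N where "N = n * s + n"
  \<comment> \<open>For \<open>j \<le> N\<close> the \<tau>-degree is at most
    \<open>s + j * d \<le> s + N * d\<close>, so all these functions are expanded in the same
    monomials.\<close>
  have "\<forall>xj\<in>X \<times> {..N}. \<exists>a. \<forall>y\<in>F. \<phi> (fst xj) ((t ^^ snd xj) y) =
      (\<Sum>i<n. \<Sum>k\<le>s + N * d. a i k * (y $ i) ^ (q ^ k))"
  proof
    fix xj assume "xj \<in> X \<times> {..N}"
    then have "(\<lambda>y. \<phi> (fst xj) ((t ^^ snd xj) y)) \<in> additive_fun q n F (s + N * d)"
      by (intro additive_fun_mono[OF additive_fun_funpow[OF d \<phi>_s]]) auto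
    then show "\<exists>a. \<forall>y\<in>F. \<phi> (fst xj) ((t ^^ snd xj) y) =
        (\<Sum>i<n. \<Sum>k\<le>s + N * d. a i k * (y $ i) ^ (q ^ k))"
      by (simp add: additive_fun_def)
  qed
  then obtain a where a: "\<forall>xj\<in>X \<times> {..N}. \<forall>y\<in>F. \<phi> (fst xj) ((t ^^ snd xj) y) =
      (\<Sum>i<n. \<Sum>k\<le>s + N * d. a xj i k * (y $ i) ^ (q ^ k))"
    by (rule bchoice[THEN exE])
  \<comment> \<open>The terms \<open>n * d * N\<close> on both sides cancel, \<open>N\<close>
    accounts for \<open>n * s + n\<close>, and a surplus of \<open>n * d + 1\<close>
    remains.\<close>
  have "n * (s + N * d + 1) < (n * d + 1) * (N + 1)"
    by (simp add: N_def algebra_simps)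
  also have "\<dots> \<le> card X * (N + 1)" using X(3) by (intro mult_right_mono) auto
  finally have "card ({..<n} \<times> {..s + N * d}) < card (X \<times> {..N})"
    by (simp add: card_cartesian_product)
  then obtain c where c: "\<exists>xj\<in>X \<times> {..N}. c xj \<noteq> 0"
    "\<forall>ik\<in>{..<n} \<times> {..s + N * d}. (\<Sum>xj\<in>X \<times> {..N}. a xj (fst ik) (snd ik) * c xj) = 0"
    using homogeneous_system[of "{..<n} \<times> {..s + N * d}" "X \<times> {..N}"
        "\<lambda>ik xj. a xj (fst ik) (snd ik)"] X(1) by auto
  \<comment> \<open>The scalars belonging to one \<open>x\<close> are collected into a polynomial,
    which turns a relation over K between the T^j x into one over K[T] between the
    \<open>x\<close>.\<close>
  define P where "P x = (\<Sum>j\<le>N. monom (c (x, j)) j)" for x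
  have coeff_P: "coeff (P x) j = (if j \<le> N then c (x, j) else 0)" for x j
    by (simp add: P_def coeff_sum)
  have "degree (P x) \<le> N" for x
    by (rule degree_le) (simp add: coeff_P)
  then have act_P: "act (P x) f y = (\<Sum>j\<le>N. c (x, j) * f ((t ^^ j) y))" for x f y
    by (simp add: act_upto[of _ N] coeff_P)
  have "M.lincomb P X = finsum M (\<lambda>x. cls (act (P x) (\<phi> x))) X"
    unfolding M.lincomb_def
  proof (rule M.finsum_cong')
    show "P x \<odot>\<^bsub>M\<^esub> x = cls (act (P x) (\<phi> x))" if "x \<in> X" for x
      using smult_M[OF \<phi>_funs[OF that]] cls[OF that, symmetric] by simp
    show "(\<lambda>x. cls (act (P x) (\<phi> x))) \<in> X \<rightarrow> carrier M"
      using \<phi>_funs by (auto simp: carrier_M act_closed)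
  qed simp
  also have "\<dots> = cls (\<lambda>y. \<Sum>x\<in>X. act (P x) (\<phi> x) y)"
    using X(1) \<phi>_funs by (intro finsum_cls cls_group_M) (auto simp: act_closed)
  also have "\<dots> = \<zero>\<^bsub>M\<^esub>"
  proof -
    have "(\<Sum>x\<in>X. act (P x) (\<phi> x) y) = 0" if y: "y \<in> F" for y
    proof -
      have "(\<Sum>x\<in>X. act (P x) (\<phi> x) y) = (\<Sum>xj\<in>X \<times> {..N}. c xj * \<phi> (fst xj) ((t ^^ snd xj) y))"
        by (simp add: act_P sum.cartesian_product case_prod_unfold)
      also have "\<dots> = (\<Sum>xj\<in>X \<times> {..N}. \<Sum>i<n. \<Sum>k\<le>s + N * d. a xj i k * c xj * (y $ i) ^ (q ^ k))"
      proof (rule sum.cong[OF refl])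
        fix xj assume "xj \<in> X \<times> {..N}"
        with a y have "\<phi> (fst xj) ((t ^^ snd xj) y) =
            (\<Sum>i<n. \<Sum>k\<le>s + N * d. a xj i k * (y $ i) ^ (q ^ k))" by blast
        then show "c xj * \<phi> (fst xj) ((t ^^ snd xj) y) =
            (\<Sum>i<n. \<Sum>k\<le>s + N * d. a xj i k * c xj * (y $ i) ^ (q ^ k))"
          by (simp only: sum_distrib_left mult.assoc mult.left_commute)
      qed
      \<comment> \<open>The sums are exchanged until the one over \<open>X \<times> {..N}\<close> is
        innermost, where the equations for \<open>c\<close> apply.\<close>
      also have "\<dots> = (\<Sum>i<n. \<Sum>xj\<in>X \<times> {..N}. \<Sum>k\<le>s + N * d. a xj i k * c xj * (y $ i) ^ (q ^ k))"
        by (rule sum.swap)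
      also have "\<dots> = (\<Sum>i<n. \<Sum>k\<le>s + N * d. \<Sum>xj\<in>X \<times> {..N}. a xj i k * c xj * (y $ i) ^ (q ^ k))"
        by (intro sum.cong sum.swap refl)
      also have "\<dots> = (\<Sum>i<n. \<Sum>k\<le>s + N * d. (\<Sum>xj\<in>X \<times> {..N}. a xj i k * c xj) * (y $ i) ^ (q ^ k))"
        by (simp add: sum_distrib_right)
      also have "\<dots> = 0"
        using c(2) by (auto intro!: sum.neutral)
      finally show ?thesis .
    qed
    moreover have "(\<lambda>y. \<Sum>x\<in>X. act (P x) (\<phi> x) y) \<in> funs"
      using \<phi>_funs by (intro funs_sum act_closed)
    ultimately show ?thesis
      by (simp add: zero_M cls_eq_iff)
  qed
  finally have "M.lincomb P X = \<zero>\<^bsub>M\<^esub>" .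
  moreover obtain x j where "x \<in> X" "j \<le> N" "c (x, j) \<noteq> 0" using c(1) by auto
  then have "P x \<noteq> 0" using coeff_P[of x j] by auto
  ultimately show ?thesis
    using X(1) \<open>x \<in> X\<close> by (intro M.lin_dep_crit[of X X P x]) auto
qed

end

theorem theorem6p5:
  fixes p q n :: nat
    and \<delta> :: "'k::alg_closed_field poly \<Rightarrow> 'k"
    and F :: "'k vec set"
    and \<Phi> :: "'k poly \<Rightarrow> 'k vec \<Rightarrow> 'k vec"
  assumes "prime p" and "CHAR('k) = p" and "\<exists>e>0. q = p ^ e"
    and "structure_morphism q \<delta>"
    and "q_variety q n F"
    and "A_module_structure q n \<delta> F \<Phi>"
  shows "vectorspace class_ring (KF_generic q n F \<Phi>) \<and>
         vectorspace.fin_dim class_ring (KF_generic q n F \<Phi>)"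
proof -
  from assms(3) obtain e where e: "e > 0" "q = p ^ e" by blast
  interpret A: A_structure p e q n \<delta> F \<Phi>
    using assms e by unfold_locales
  \<comment> \<open>The scalars are extended from K[T] to its fraction field K(T); the module
    structure over K[T] comes from \<open>A.module_M\<close>.\<close>
  interpret E: extension_of_scalars class_ring "KF_module q n F \<Phi>"
      "class_ring :: 'k poly fract ring" to_fract
    by unfold_locales simp
  obtain d where "\<And>j. j < n \<Longrightarrow> (\<lambda>x. A.t x $ j) \<in> additive_fun q n F d"
    by (rule A.t_degree) blast
  \<comment> \<open>The embedding of K[T] into K(T) has trivial kernel, and
    \<open>A.lin_dep_M\<close> supplies the bound \<open>D = n * d\<close>.\<close>
  then show ?thesis
    unfolding KF_generic_def
    by (intro E.fin_dim_base_change[of "n * d"] A.lin_dep_M class_field) auto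
qed

end
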